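(* Let $E$ be a compact non-polar subset of $\overline{D(0,1/4)}=\{z\in\mathbb{C}:|z|\le 1/4\}$. For $n\in\mathbb{N}$, $n \geq 1$, set $$K_n = \bigcup_{j=1}^n(E+j).$$ Then $$\lim_{n \to +\infty}\dfrac{\operatorname{cap}(K_n)}{\operatorname{cap}([0,n])} = 1,$$ where $[0,n]\subset\mathbb{R}\subset\mathbb{C}$ is the closed interval. Moreover, $\log(\operatorname{cap}(K_n)) = \log(n/4) + \mathcal{O}(1/\sqrt{n})$.
   Context: For a finite positive Borel measure $\mu$ on $\mathbb{C}$ with compact support, its (logarithmic) energy is $I(\mu)=\int\int\log|z-w|\,d\mu(w)\,d\mu(z)\in[-\infty,+\infty)$. For $X\subseteq\mathbb{C}$, the logarithmic capacity is $\operatorname{cap}(X)=\sup_\mu \exp(I(\mu))$, the supremum being over all Borel probability measures $\mu$ whose support is a compact subset of $X$ (with $\exp(-\infty)=0$). $X$ is polar if $\operatorname{cap}(X)=0$, and non-polar otherwise. Notation: $a_n=\mathcal{O}(b_n)$ means that there exist $C>0$ and $N\in\mathbb{N}$ such that $|a_n|\le C b_n$ for all $n\ge N$. *)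

theory Defs
  imports "HOL-Probability.Probability"
begin

text \<open>
  Lebesgue integral of an extended-real function, as the integral of the positive part minus the
  integral of the negative part (\<^const>\<open>e2ennreal\<close> sends negative arguments to 0). It is
  meaningful when at most one of the two is infinite. For the logarithmic kernel below and finite
  measures of compact support the positive part always has a finite integral.
\<close>
definition ereal_integral :: "'a measure \<Rightarrow> ('a \<Rightarrow> ereal) \<Rightarrow> ereal" where
  "ereal_integral M f =
     enn2ereal (\<integral>\<^sup>+x. e2ennreal (f x) \<partial>M) - enn2ereal (\<integral>\<^sup>+x. e2ennreal (- f x) \<partial>M)"

text \<open>
  The value on the diagonal is given explicitly because \<^const>\<open>ln\<close> satisfies
  \<^prop>\<open>ln (0::real) = 0\<close>; without it, point masses would have energy 0.
\<close>
definition log_kernel :: "complex \<Rightarrow> complex \<Rightarrow> ereal" where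
  "log_kernel z w = (if z = w then - \<infinity> else ereal (ln (cmod (z - w))))"

definition log_energy :: "complex measure \<Rightarrow> ereal" where
  "log_energy M = ereal_integral M (\<lambda>z. ereal_integral M (\<lambda>w. log_kernel z w))"

definition measure_support :: "'a::topological_space measure \<Rightarrow> 'a set" where
  "measure_support M = {x. \<forall>U. open U \<and> x \<in> U \<longrightarrow> 0 < emeasure M U}"

definition exp_ereal :: "ereal \<Rightarrow> ennreal" where
  "exp_ereal x = (case x of ereal r \<Rightarrow> ennreal (exp r) | PInfty \<Rightarrow> \<infinity> | MInfty \<Rightarrow> 0)"

text \<open>
  The supremum is taken in \<^typ>\<open>ennreal\<close>, where it always exists (unbounded sets may have
  infinite capacity) and where the supremum of the empty set is 0.
\<close>
definition log_capacity :: "complex set \<Rightarrow> ennreal" where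
  "log_capacity X =
     (SUP M \<in> {M. sets M = sets borel \<and> prob_space M \<and>
                  compact (measure_support M) \<and> measure_support M \<subseteq> X}.
        exp_ereal (log_energy M))"

definition polar_set :: "complex set \<Rightarrow> bool" where
  "polar_set X \<longleftrightarrow> log_capacity X = 0"

definition union_translates :: "complex set \<Rightarrow> nat \<Rightarrow> complex set" where
  "union_translates E n = (\<Union>j\<in>{1..n}. (\<lambda>z. z + of_nat j) ` E)"

end

theory Submission
  imports Defs "HOL-Real_Asymp.Real_Asymp"
begin

text \<open>
  Both capacities are squeezed between explicit multiples of \<open>n / 4\<close>.

  Upper bounds. A probability measure carried by a set contains, for every \<open>N\<close>, \<open>N\<close> distinct points
  of that set whose mean mutual logarithmic energy is at least that of the measure: the average over
  independent points is the energy, so some choice does as well as the average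
  (\<open>exists_low_energy_set\<close>). In return, the product of the mutual distances of \<open>N\<close> points is controlled
  by any sequence of monic polynomials that are small on the set (\<open>vandermonde_bound\<close>), by Lagrange
  interpolation. Both the segment \<open>[0,n]\<close> and \<open>K\<^sub>n\<close> lie in a region bounded by an ellipse, namely the
  image of \<open>1 \<le> |\<zeta>| \<le> r\<close> under \<open>\<zeta> \<mapsto> c + (n/4)(\<zeta> + 1/\<zeta>)\<close>. There the rescaled Dickson polynomials are
  at most \<open>2 (n r / 4)\<^sup>m\<close>, so letting \<open>N\<close> tend to infinity gives capacity at most \<open>n r / 4\<close>
  (\<open>log_capacity_joukowski_le\<close>). For the segment \<open>r = 1\<close>; for \<open>K\<^sub>n\<close>, whose points have distance at most
  \<open>1/4\<close> from a segment of length \<open>n\<close>, one can take \<open>r = exp (1 / sqrt n)\<close>.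

  Lower bounds. Let \<open>\<nu>\<close> be a measure of finite energy on \<open>E\<close>, and let \<open>x\<^sub>0, \<dots>, x\<^sub>n\<^sub>-\<^sub>1\<close> be the Chebyshev
  nodes of \<open>[0,n]\<close>. The test measure on \<open>K\<^sub>n\<close> is the average of the translates of \<open>\<nu>\<close> by
  \<open>\<lceil>x\<^sub>k\<rceil>\<close>. Replacing \<open>log |x\<^sub>k - x\<^sub>l|\<close> by the mutual energy of two such translates costs
  at most a constant times \<open>1 / (1 + |x\<^sub>k - x\<^sub>l|)\<close> (\<open>translated_pair_energy_le\<close>). The sum of
  the logarithms is bounded below through the derivative of the Chebyshev polynomial at its zeros
  (\<open>node_product_ge\<close>) and gives \<open>log (n / 4)\<close>. Since \<open>|x\<^sub>k - x\<^sub>l| \<ge> (k - l)\<^sup>2 / n\<close>, the average of the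
  costs is of order \<open>1 / sqrt n\<close>, and this is where the error term in the theorem comes from.

  The lower bound for the segment is the lower bound for \<open>K\<^sub>n\<^sub>-\<^sub>1\<close> with \<open>E = [-1/4, 1/4]\<close>,
  since that union lies inside \<open>[0,n]\<close>.
\<close>

section \<open>Dickson polynomials\<close>

text \<open>
  The Dickson polynomials with parameter 1, which are \<open>2 T\<^sub>n(x / 2)\<close> for the Chebyshev polynomials
  \<open>T\<^sub>n\<close>. This normalisation makes them monic for positive \<open>n\<close>.
\<close>
fun dickson :: "nat \<Rightarrow> 'a::comm_ring_1 poly" where
  "dickson 0 = [:2:]"
| "dickson (Suc 0) = [:0, 1:]"
| "dickson (Suc (Suc n)) = [:0, 1:] * dickson (Suc n) - dickson n"

lemma poly_dickson:
  fixes z :: "'a::field"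
  assumes "z \<noteq> 0"
  shows "poly (dickson n) (z + 1 / z) = z ^ n + 1 / z ^ n"
proof (induction n rule: dickson.induct)
  case (3 n)
  have "poly (dickson (Suc (Suc n))) (z + 1 / z) =
      (z + 1 / z) * (z ^ Suc n + 1 / z ^ Suc n) - (z ^ n + 1 / z ^ n)"
    using 3 by simp
  also have "\<dots> = z ^ Suc (Suc n) + 1 / z ^ Suc (Suc n)"
    using assms by (simp add: divide_simps) (simp add: algebra_simps)
  finally show ?case .
qed auto

lemma poly_dickson_cos: "poly (dickson n) (2 * cos t) = 2 * cos (real n * t)"
proof (induction n rule: dickson.induct)
  case (3 n)
  have "2 * cos t * cos (real (Suc n) * t) = cos (real (Suc n) * t + t) + cos (real (Suc n) * t - t)"
    by (simp only: cos_add cos_diff) simp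
  also have "real (Suc n) * t + t = real (Suc (Suc n)) * t"
    by (simp add: algebra_simps)
  also have "real (Suc n) * t - t = real n * t"
    by (simp add: algebra_simps)
  finally show ?case using 3 by (simp only: dickson.simps poly_diff poly_mult) simp
qed auto

lemma degree_dickson_le: "degree (dickson n) \<le> n"
proof (induction n rule: dickson.induct)
  case (3 n)
  have "degree ([:0, 1:] * dickson (Suc n) :: 'a poly) \<le> Suc (Suc n)"
    using 3(1) by (simp)
  with 3 show ?case by (auto intro!: degree_diff_le)
qed auto

lemma coeff_dickson: "n > 0 \<Longrightarrow> coeff (dickson n) n = 1"
proof (induction n rule: dickson.induct)
  case (3 n)
  have "coeff (dickson n :: 'a poly) (Suc (Suc n)) = 0"
    using degree_dickson_le[of n, where 'a = 'a] by (intro coeff_eq_0) auto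
  with 3 show ?case by simp
qed auto

section \<open>Products of distances and monic polynomials\<close>

text \<open>
  The induction step for double sums and double products over ordered pairs of distinct elements.
\<close>
lemma (in comm_monoid_set) off_diagonal_insert:
  fixes g :: "'b \<Rightarrow> 'b \<Rightarrow> 'a"
  assumes "finite A" "x \<notin> A"
  shows "F (\<lambda>a. F (g a) (insert x A - {a})) (insert x A) =
    F (g x) A \<^bold>* (F (\<lambda>a. g a x) A \<^bold>* F (\<lambda>a. F (g a) (A - {a})) A)"
proof -
  have "F (g a) (insert x A - {a}) = g a x \<^bold>* F (g a) (A - {a})" if "a \<in> A" for a
  proof -
    have "insert x A - {a} = insert x (A - {a})" using that assms by auto
    then show ?thesis using assms by simp
  qed
  then have "F (\<lambda>a. F (g a) (insert x A - {a})) A = F (\<lambda>a. g a x \<^bold>* F (g a) (A - {a})) A"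
    by (intro cong) auto
  also have "\<dots> = F (\<lambda>a. g a x) A \<^bold>* F (\<lambda>a. F (g a) (A - {a})) A"
    by (rule distrib)
  finally show ?thesis using assms by simp
qed

text \<open>
  The left-hand side is the leading coefficient of the Lagrange interpolation polynomial of \<open>P\<close> at
  the points of \<open>F\<close>, and that polynomial is \<open>P\<close> itself because there are more points than the
  degree.
\<close>
lemma monic_interpolation_sum:
  fixes P :: "'a::field poly"
  assumes F: "finite F" "card F = Suc m" and P: "degree P \<le> m" "coeff P m = 1"
  shows "(\<Sum>x\<in>F. poly P x / (\<Prod>y\<in>F - {x}. x - y)) = 1"
proof -
  define L where "L = (\<lambda>x. \<Prod>y\<in>F - {x}. [:- y, 1:])"
  define c where "c = (\<lambda>x. poly P x / (\<Prod>y\<in>F - {x}. x - y))"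
  define Q where "Q = (\<Sum>x\<in>F. smult (c x) (L x))"
  have degL: "degree (L x) = m" if "x \<in> F" for x
    unfolding L_def using that F by (subst degree_prod_eq_sum_degree) auto
  have coeffL: "coeff (L x) m = 1" if "x \<in> F" for x
    using degL[OF that] lead_coeff_prod[of "\<lambda>y. [:- y, 1:]" "F - {x}"] by (simp add: L_def)
  have "poly Q x = poly P x" if x: "x \<in> F" for x
  proof -
    have "poly Q x = (\<Sum>z\<in>F. c z * (\<Prod>y\<in>F - {z}. x - y))"
      by (simp add: Q_def L_def poly_sum poly_prod)
    also have "\<dots> = (\<Sum>z\<in>{x}. c z * (\<Prod>y\<in>F - {z}. x - y))"
      using F x by (intro sum.mono_neutral_right) (auto intro!: bexI[of _ x])
    also have "\<dots> = poly P x" using F by (simp add: c_def)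
    finally show ?thesis .
  qed
  moreover have "degree Q \<le> m"
    unfolding Q_def using degL by (intro degree_sum_le F) (auto intro: order.trans[OF degree_smult_le])
  ultimately have "P = Q"
    using F P by (intro poly_eqI_degree[of F]) auto
  then have "coeff Q m = 1" using P by simp
  then show ?thesis by (simp add: Q_def coeff_sum coeffL c_def)
qed

text \<open>
  If every product of distances were larger, then each of the \<open>Suc m\<close> terms in the interpolation
  identity above would be smaller than \<open>1 / Suc m\<close>, and their sum could not be 1.
\<close>
lemma exists_small_product:
  fixes P :: "complex poly"
  assumes F: "finite F" "card F = Suc m" and P: "degree P \<le> m" "coeff P m = 1"
    and B: "\<And>x. x \<in> F \<Longrightarrow> cmod (poly P x) \<le> B"
  shows "\<exists>x\<in>F. (\<Prod>y\<in>F - {x}. cmod (x - y)) \<le> real (Suc m) * B"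
proof (rule ccontr)
  assume "\<not> ?thesis"
  then have neg: "real (Suc m) * B < (\<Prod>y\<in>F - {x}. cmod (x - y))" if "x \<in> F" for x
    using that by (auto simp: not_le)
  have "1 = cmod (\<Sum>x\<in>F. poly P x / (\<Prod>y\<in>F - {x}. x - y))"
    using monic_interpolation_sum[OF F P] by simp
  also have "\<dots> \<le> (\<Sum>x\<in>F. cmod (poly P x) / (\<Prod>y\<in>F - {x}. cmod (x - y)))"
    by (rule order.trans[OF norm_sum]) (simp add: norm_divide prod_norm)
  also have "\<dots> < (\<Sum>x\<in>F. 1 / real (Suc m))"
  proof (rule sum_strict_mono)
    fix x assume x: "x \<in> F"
    have pos: "0 < (\<Prod>y\<in>F - {x}. cmod (x - y))" by (intro prod_pos) auto
    have "real (Suc m) * cmod (poly P x) \<le> real (Suc m) * B" using B[OF x] by (intro mult_left_mono) auto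
    with neg[OF x] have "real (Suc m) * cmod (poly P x) < (\<Prod>y\<in>F - {x}. cmod (x - y))"
      by (rule le_less_trans[rotated])
    then show "cmod (poly P x) / (\<Prod>y\<in>F - {x}. cmod (x - y)) < 1 / real (Suc m)"
      using pos by (simp add: divide_simps mult.commute)
  qed (use F in auto)
  also have "\<dots> = 1" using F by simp
  finally show False by simp
qed

text \<open>
  Removing the point found in the previous lemma from a set of \<open>N\<close> points splits two factors, each at most
  \<open>N * B (N - 1)\<close>, off the squared Vandermonde determinant; the rest is induction. The factors \<open>Suc m\<close>
  contribute \<open>O (N log N)\<close> to the logarithm, which is negligible against the number \<open>N (N - 1)\<close> of pairs.
\<close>
lemma vandermonde_bound:
  fixes P :: "nat \<Rightarrow> complex poly"
  assumes P: "\<And>m. degree (P m) \<le> m" "\<And>m. coeff (P m) m = 1"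
    and B: "\<And>m x. x \<in> X \<Longrightarrow> cmod (poly (P m) x) \<le> B m" "\<And>m. 0 \<le> B m"
  shows "finite F \<Longrightarrow> F \<subseteq> X \<Longrightarrow> card F = N \<Longrightarrow>
    (\<Prod>x\<in>F. \<Prod>y\<in>F - {x}. cmod (x - y)) \<le> (\<Prod>m<N. real (Suc m) * B m)\<^sup>2"
proof (induction N arbitrary: F)
  case (Suc m)
  obtain x where x: "x \<in> F" "(\<Prod>y\<in>F - {x}. cmod (x - y)) \<le> real (Suc m) * B m"
    using exists_small_product[of F m "P m" "B m"] Suc.prems P B by blast
  define G where "G = F - {x}"
  have F: "F = insert x G" "x \<notin> G" "finite G" using x Suc.prems by (auto simp: G_def)
  have le: "(\<Prod>y\<in>G. cmod (x - y)) \<le> real (Suc m) * B m" using x by (simp add: G_def)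
  have IH: "(\<Prod>x\<in>G. \<Prod>y\<in>G - {x}. cmod (x - y)) \<le> (\<Prod>m<m. real (Suc m) * B m)\<^sup>2"
    using Suc.prems x by (intro Suc.IH) (auto simp: G_def)
  have "(\<Prod>x\<in>F. \<Prod>y\<in>F - {x}. cmod (x - y)) =
      (\<Prod>y\<in>G. cmod (x - y)) * ((\<Prod>y\<in>G. cmod (x - y)) * (\<Prod>x\<in>G. \<Prod>y\<in>G - {x}. cmod (x - y)))"
    unfolding F(1) by (subst prod.off_diagonal_insert[OF F(3,2)]) (simp add: norm_minus_commute)
  also have "\<dots> \<le> (real (Suc m) * B m) * ((real (Suc m) * B m) * (\<Prod>m<m. real (Suc m) * B m)\<^sup>2)"
    using le IH B by (intro mult_mono) (auto intro!: prod_nonneg mult_nonneg_nonneg)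
  also have "\<dots> = (\<Prod>m<Suc m. real (Suc m) * B m)\<^sup>2"
    by (simp only: prod.lessThan_Suc power2_eq_square) (simp only: ac_simps)
  finally show ?case .
qed auto

section \<open>Images of annuli under the Joukowski map\<close>

text \<open>
  The closed region inside the ellipse with foci \<open>c \<plusminus> 2 a\<close> and sum of semi-axes \<open>2 a r\<close>; for \<open>r = 1\<close> it
  degenerates to the segment between the foci.
\<close>
definition joukowski_image :: "complex \<Rightarrow> real \<Rightarrow> real \<Rightarrow> complex set" where
  "joukowski_image c a r = {c + of_real a * (\<zeta> + 1 / \<zeta>) | \<zeta>. 1 \<le> cmod \<zeta> \<and> cmod \<zeta> \<le> r}"

text \<open>
  The polynomials are rescaled Dickson polynomials, whose value at \<open>\<zeta> + 1 / \<zeta>\<close> is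
  \<open>\<zeta>\<^sup>m + 1 / \<zeta>\<^sup>m\<close>. Only degree 0 is different, as the zeroth Dickson polynomial is 2.
\<close>
lemma monic_poly_joukowski_image:
  assumes a: "a > 0" and r: "1 \<le> r"
  shows "\<exists>P. degree P \<le> m \<and> coeff P m = 1 \<and>
    (\<forall>z\<in>joukowski_image c a r. cmod (poly P z) \<le> 2 * (a * r) ^ m)"
proof (cases "m = 0")
  case True
  then show ?thesis by (intro exI[of _ 1]) auto
next
  case False
  define P where "P = smult (of_real a ^ m) (dickson m \<circ>\<^sub>p [:- c / of_real a, 1 / of_real a:])"
  have deg: "degree (dickson m :: complex poly) = m"
    using degree_dickson_le[of m, where 'a = complex] coeff_dickson[of m, where 'a = complex] False
    by (metis bot_nat_0.not_eq_extremum le_antisym le_degree zero_neq_one)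
  have degP: "degree P = m"
    using a by (simp add: P_def degree_pcompose deg)
  have "lead_coeff (dickson m \<circ>\<^sub>p [:- c / of_real a, 1 / of_real a:]) = 1 / of_real a ^ m"
    using a False by (subst lead_coeff_comp) (auto simp: deg coeff_dickson power_one_over)
  then have coeffP: "coeff P m = 1"
    using a by (simp add: P_def degree_pcompose deg)
  have "cmod (poly P z) \<le> 2 * (a * r) ^ m" if z: "z \<in> joukowski_image c a r" for z
  proof -
    obtain w where w: "z = c + of_real a * (w + 1 / w)" "1 \<le> cmod w" "cmod w \<le> r"
      using z by (auto simp: joukowski_image_def)
    have w0: "w \<noteq> 0" using w by auto
    have arg: "- c / of_real a + z * (1 / of_real a) = w + 1 / w"
      using a by (simp add: w(1) field_simps)
    have "poly P z = of_real a ^ m * (w ^ m + 1 / w ^ m)"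
      using w0 arg by (simp add: P_def poly_pcompose poly_dickson)
    moreover have "cmod (w ^ m + 1 / w ^ m) \<le> r ^ m + r ^ m"
    proof (rule order.trans[OF norm_triangle_ineq add_mono])
      show "cmod (w ^ m) \<le> r ^ m" using w by (simp add: norm_power power_mono)
      have "1 \<le> cmod w ^ m" "1 \<le> r ^ m" using w r by (auto intro: one_le_power)
      then show "cmod (1 / w ^ m) \<le> r ^ m"
        by (simp add: norm_divide norm_power divide_simps) (smt (verit) mult_le_cancel_left1)
    qed
    ultimately show ?thesis
      using a by (simp add: norm_mult norm_power power_mult_distrib)
  qed
  then show ?thesis using degP coeffP by (intro exI[of _ P]) auto
qed

lemma off_diagonal_log_sum_le:
  assumes a: "a > 0" and r: "1 \<le> r" and F: "finite F" "F \<subseteq> joukowski_image c a r"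
    and N: "card F = N" "N > 0"
  shows "(\<Sum>x\<in>F. \<Sum>y\<in>F - {x}. ln (cmod (x - y)))
    \<le> 2 * real N * ln (2 * real N) + real N * (real N - 1) * ln (a * r)"
proof -
  have "\<forall>m. \<exists>P. degree P \<le> m \<and> coeff P m = 1 \<and>
      (\<forall>z\<in>joukowski_image c a r. cmod (poly P z) \<le> 2 * (a * r) ^ m)"
    using monic_poly_joukowski_image[OF a r] by blast
  then obtain P where P: "\<And>m. degree (P m) \<le> m" "\<And>m. coeff (P m) m = 1"
    "\<And>m z. z \<in> joukowski_image c a r \<Longrightarrow> cmod (poly (P m) z) \<le> 2 * (a * r) ^ m"
    by metis
  have pos: "0 < cmod (x - y)" if "y \<in> F - {x}" for x y using that by auto
  have "(\<Sum>x\<in>F. \<Sum>y\<in>F - {x}. ln (cmod (x - y))) = ln (\<Prod>x\<in>F. \<Prod>y\<in>F - {x}. cmod (x - y))"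
    using F(1) pos by (subst ln_prod) (auto intro!: prod_pos sum.cong ln_prod[symmetric])
  also have "\<dots> \<le> ln ((\<Prod>m<N. real (Suc m) * (2 * (a * r) ^ m))\<^sup>2)"
  proof (rule ln_mono)
    show "(\<Prod>x\<in>F. \<Prod>y\<in>F - {x}. cmod (x - y)) \<le> (\<Prod>m<N. real (Suc m) * (2 * (a * r) ^ m))\<^sup>2"
      using a r F N P by (intro vandermonde_bound[of P]) auto
  qed (auto intro!: prod_pos)
  also have "\<dots> = 2 * (\<Sum>m<N. ln (real (Suc m) * (2 * (a * r) ^ m)))"
  proof -
    have pos: "0 < real (Suc m) * (2 * (a * r) ^ m)" for m using a r by auto
    then have "ln (\<Prod>m<N. real (Suc m) * (2 * (a * r) ^ m)) = (\<Sum>m<N. ln (real (Suc m) * (2 * (a * r) ^ m)))"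
      by (intro ln_prod) (simp, metis less_irrefl)
    then show ?thesis using pos a r by (subst ln_realpow) (auto simp del: of_nat_Suc intro!: prod_pos)
  qed
  also have "(\<Sum>m<N. ln (real (Suc m) * (2 * (a * r) ^ m))) \<le> (\<Sum>m<N. ln (2 * real N) + real m * ln (a * r))"
  proof (rule sum_mono)
    fix m assume "m \<in> {..<N}"
    then have "ln (2 * real (Suc m)) \<le> ln (2 * real N)" by simp
    moreover have "ln (real (Suc m) * (2 * (a * r) ^ m)) = ln (2 * real (Suc m)) + real m * ln (a * r)"
    proof -
      have "real (Suc m) * (2 * (a * r) ^ m) = (2 * real (Suc m)) * (a * r) ^ m" by (simp add: ac_simps)
      then show ?thesis using a r by (simp add: ln_mult ln_realpow del: of_nat_Suc)
    qed
    ultimately show "ln (real (Suc m) * (2 * (a * r) ^ m)) \<le> ln (2 * real N) + real m * ln (a * r)" by simp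
  qed
  also have "\<dots> = real N * ln (2 * real N) + (\<Sum>m<N. real m) * ln (a * r)"
    by (simp add: sum.distrib sum_distrib_right)
  also have "(\<Sum>m<N. real m) = real N * (real N - 1) / 2"
    by (induction N) (auto simp: field_simps)
  finally show ?thesis by (simp add: distrib_left)
qed

text \<open>
  The difference of the two sides vanishes at 1 and has the derivative \<open>(1 - 1 / u)\<^sup>2\<close>.
\<close>
lemma two_ln_le: "1 \<le> u \<Longrightarrow> 2 * ln u \<le> u - 1 / (u::real)"
proof -
  assume u: "1 \<le> u"
  have "1 - 1 / 1 - 2 * ln 1 \<le> u - 1 / u - 2 * ln u"
  proof (rule DERIV_nonneg_imp_nondecreasing[OF u])
    fix x :: real assume x: "1 \<le> x" "x \<le> u"
    have "((\<lambda>x. x - 1 / x - 2 * ln x) has_real_derivative (1 - 1 / x)\<^sup>2) (at x)"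
      using x by (auto intro!: derivative_eq_intros simp: power2_eq_square field_simps)
    then show "\<exists>y. ((\<lambda>x. x - 1 / x - 2 * ln x) has_real_derivative y) (at x) \<and> 0 \<le> y"
      by (intro exI[of _ "(1 - 1 / x)\<^sup>2"]) auto
  qed
  then show ?thesis by simp
qed

lemma ln_squared_le:
  fixes r :: real
  assumes r: "1 \<le> r"
  shows "(ln r)\<^sup>2 \<le> r + 1 / r - 2"
proof -
  have "0 \<le> ln r" using r by simp
  moreover have "ln r \<le> sqrt r - 1 / sqrt r"
    using two_ln_le[of "sqrt r"] r by (simp add: ln_sqrt)
  ultimately have "(ln r)\<^sup>2 \<le> (sqrt r - 1 / sqrt r)\<^sup>2" by (simp add: power_mono)
  also have "\<dots> = r + 1 / r - 2" using r by (simp add: power2_diff power_divide)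
  finally show ?thesis .
qed

text \<open>
  The two preimages of \<open>2 y\<close> under \<open>w \<mapsto> w + 1 / w\<close> are reciprocal, so one of them is outside the open unit
  disc. The last identity says that the circle \<open>|w| = r\<close> is mapped to an ellipse with foci \<open>2\<close> and \<open>-2\<close>; it
  turns distances to the foci into a bound for \<open>r\<close>.
\<close>
lemma joukowski_parameter:
  obtains w where "1 \<le> cmod w" "2 * y = w + 1 / w" "cmod (y - 1) + cmod (y + 1) = cmod w + 1 / cmod w"
proof -
  define v where "v = y + csqrt (y\<^sup>2 - 1)"
  have prod: "v * (y - csqrt (y\<^sup>2 - 1)) = 1"
    by (simp add: v_def square_diff_square_factored[symmetric] power2_eq_square[symmetric])
  then have v0: "v \<noteq> 0" by auto
  have inv: "1 / v = y - csqrt (y\<^sup>2 - 1)" using prod v0 by (simp add: field_simps)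
  \<comment> \<open>\<open>v\<close> and \<open>1 / v\<close> are the two solutions.\<close>
  define w where "w = (if 1 \<le> cmod v then v else 1 / v)"
  have w0: "w \<noteq> 0" using v0 by (simp add: w_def)
  have 1: "1 \<le> cmod w" using v0 by (auto simp: w_def norm_divide divide_simps)
  have "v + 1 / v = 2 * y" unfolding inv by (simp add: v_def)
  then have 2: "2 * y = w + 1 / w" by (auto simp: w_def add.commute)
  have "y - 1 = (w - 1)\<^sup>2 / (2 * w)" "y + 1 = (w + 1)\<^sup>2 / (2 * w)"
  proof -
    have y: "y = (w + 1 / w) / 2" unfolding 2[symmetric] by simp
    show "y - 1 = (w - 1)\<^sup>2 / (2 * w)" "y + 1 = (w + 1)\<^sup>2 / (2 * w)"
      unfolding y using w0 by (simp_all add: divide_simps power2_eq_square) (simp_all add: algebra_simps)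
  qed
  then have "cmod (y - 1) + cmod (y + 1) = ((cmod (w - 1))\<^sup>2 + (cmod (w + 1))\<^sup>2) / (2 * cmod w)"
    by (simp add: norm_divide norm_mult norm_power add_divide_distrib)
  also have "(cmod (w - 1))\<^sup>2 + (cmod (w + 1))\<^sup>2 = 2 * (cmod w)\<^sup>2 + 2"
    by (simp add: cmod_power2) (simp add: power2_eq_square algebra_simps)
  also have "\<dots> / (2 * cmod w) = cmod w + 1 / cmod w"
    using w0 by (simp add: power2_eq_square field_simps)
  finally show ?thesis by (rule that[OF 1 2])
qed

text \<open>
  A point close to the segment has a sum of distances to the two end points that hardly
  exceeds the length of the segment. The square root appears because \<open>r + 1 / r - 2\<close> vanishes to
  second order at \<open>r = 1\<close>.
\<close>
lemma near_segment_in_joukowski_image: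
  assumes a: "a > 0" and t: "\<bar>t\<bar> \<le> 2 * a" and d: "cmod (z - (c + of_real t)) \<le> d"
  shows "z \<in> joukowski_image c a (exp (sqrt (d / a)))"
proof -
  define y where "y = (z - c) / of_real (2 * a)"
  define s where "s = t / (2 * a)"
  have s: "\<bar>s\<bar> \<le> 1" using a t by (simp add: s_def)
  have "y - of_real s = (z - (c + of_real t)) / of_real (2 * a)"
    using a by (simp add: y_def s_def field_simps)
  then have "cmod (y - of_real s) = cmod (z - (c + of_real t)) / (2 * a)"
    using a by (simp add: norm_divide norm_mult)
  also have "\<dots> \<le> d / (2 * a)"
    using a d by (intro divide_right_mono) auto
  finally have dist: "cmod (y - of_real s) \<le> d / (2 * a)" .
  obtain w where w: "1 \<le> cmod w" "2 * y = w + 1 / w"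
    "cmod (y - 1) + cmod (y + 1) = cmod w + 1 / cmod w"
    by (rule joukowski_parameter)
  have "cmod (y - 1) \<le> cmod (y - of_real s) + cmod (of_real s - 1)"
    by (rule norm_diff_triangle_le[OF order_refl order_refl])
  moreover have "cmod (y + 1) \<le> cmod (y - of_real s) + cmod (of_real s + 1)"
    using norm_triangle_ineq[of "y - of_real s" "of_real s + 1"] by simp
  moreover have "cmod (of_real s - 1) = 1 - s" "cmod (of_real s + 1) = 1 + s"
    using s norm_of_real[of "s - 1", where 'a = complex] norm_of_real[of "s + 1", where 'a = complex] by auto
  ultimately have "cmod w + 1 / cmod w - 2 \<le> d / a"
    using w(3) dist by simp
  then have "(ln (cmod w))\<^sup>2 \<le> d / a" using ln_squared_le[OF w(1)] by linarith
  then have "ln (cmod w) \<le> sqrt (d / a)" using real_le_rsqrt by blast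
  then have "cmod w \<le> exp (sqrt (d / a))" using w(1) by (metis exp_ln exp_le_cancel_iff less_le_trans zero_less_one)
  moreover have "z = c + of_real a * (w + 1 / w)"
    unfolding w(2)[symmetric] using a by (simp add: y_def field_simps)
  ultimately show ?thesis using w(1) by (auto simp: joukowski_image_def)
qed

lemma joukowski_image_diameter:
  assumes a: "a > 0" and z: "z \<in> joukowski_image c a r" and w: "w \<in> joukowski_image c a r"
  shows "cmod (z - w) \<le> 2 * a * (r + 1)"
proof -
  have *: "cmod (z - c) \<le> a * (r + 1)" if z: "z \<in> joukowski_image c a r" for z
  proof -
    obtain u where u: "z = c + of_real a * (u + 1 / u)" "1 \<le> cmod u" "cmod u \<le> r"
      using z unfolding joukowski_image_def by blast
    have "cmod (u + 1 / u) \<le> cmod u + 1 / cmod u"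
      using norm_triangle_ineq[of u "1 / u"] by (simp add: norm_divide)
    also have "\<dots> \<le> r + 1" using u by (intro add_mono) (auto simp: divide_simps)
    finally show ?thesis using a by (simp add: u(1) norm_mult)
  qed
  have "cmod (z - w) \<le> cmod (z - c) + cmod (c - w)"
    by (rule norm_diff_triangle_le[OF order_refl order_refl])
  then show ?thesis using *[OF z] *[OF w] by (simp add: norm_minus_commute algebra_simps)
qed

section \<open>Logarithmic energy as a nonnegative integral\<close>

text \<open>
  The integral of \<open>c - g\<close> is defined through the positive part \<open>p\<close> and the negative part \<open>q\<close>, and
  \<open>p - q = c - g\<close> cannot be integrated termwise when \<open>g\<close> is not integrable. Moving all negative
  terms to the other side gives an identity between nonnegative functions, for which this is allowed.
\<close>
lemma (in prob_space) ereal_integral_const_minus: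
  fixes g :: "'a \<Rightarrow> ennreal"
  assumes g[measurable]: "g \<in> borel_measurable M"
    and f: "AE x in M. f x = ereal c - enn2ereal (g x)"
  shows "ereal_integral M f = ereal c - enn2ereal (\<integral>\<^sup>+x. g x \<partial>M)"
proof -
  define p where "p = (\<lambda>t. e2ennreal (ereal c - enn2ereal t))"
  define q where "q = (\<lambda>t. e2ennreal (- (ereal c - enn2ereal t)))"
  have [measurable]: "p \<in> borel_measurable borel" "q \<in> borel_measurable borel"
    unfolding p_def q_def by measurable
  \<comment> \<open>\<open>ennreal\<close> maps negative numbers to 0, so \<open>ennreal (- c)\<close> is the negative part of \<open>c\<close>.\<close>
  have pq: "p t + t + ennreal (- c) = q t + ennreal c" for t
  proof (cases t)
    case (real r)
    then have "p t = ennreal (c - r)" "q t = ennreal (r - c)"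
      by (simp_all add: p_def q_def enn2ereal_ennreal)
    moreover have "ennreal (c - r) + ennreal r + ennreal (- c) = ennreal (r - c) + ennreal c"
      using real
      by (cases "c \<ge> 0"; cases "c \<ge> r") (auto simp: ennreal_neg ennreal_plus[symmetric] simp del: ennreal_plus)
    ultimately show ?thesis using real by simp
  qed (simp add: p_def q_def)
  have ple: "p t \<le> ennreal c" for t
    by (cases t) (auto simp: p_def enn2ereal_ennreal e2ennreal_neg intro!: ennreal_leI)
  have P: "(\<integral>\<^sup>+x. e2ennreal (f x) \<partial>M) = (\<integral>\<^sup>+x. p (g x) \<partial>M)"
    using f by (intro nn_integral_cong_AE) (auto simp: p_def elim!: AE_mp)
  have Q: "(\<integral>\<^sup>+x. e2ennreal (- f x) \<partial>M) = (\<integral>\<^sup>+x. q (g x) \<partial>M)"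
    using f by (intro nn_integral_cong_AE) (auto simp: q_def elim!: AE_mp)
  have "(\<integral>\<^sup>+x. p (g x) + g x + ennreal (- c) \<partial>M) = (\<integral>\<^sup>+x. q (g x) + ennreal c \<partial>M)"
    by (simp only: pq)
  then have eq: "(\<integral>\<^sup>+x. p (g x) \<partial>M) + (\<integral>\<^sup>+x. g x \<partial>M) + ennreal (- c) = (\<integral>\<^sup>+x. q (g x) \<partial>M) + ennreal c"
    by (simp add: nn_integral_add emeasure_space_1)
  have "(\<integral>\<^sup>+x. p (g x) \<partial>M) \<le> (\<integral>\<^sup>+x. ennreal c \<partial>M)"
    by (intro nn_integral_mono ple)
  then have le: "(\<integral>\<^sup>+x. p (g x) \<partial>M) \<le> ennreal c" by (simp add: emeasure_space_1)
  show ?thesis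
  proof (cases "\<integral>\<^sup>+x. g x \<partial>M")
    case top
    then have "(\<integral>\<^sup>+x. q (g x) \<partial>M) = top" using eq by (metis ennreal_add_eq_top ennreal_neq_top)
    moreover have "(\<integral>\<^sup>+x. p (g x) \<partial>M) \<noteq> top" using le by (auto simp: top_unique)
    ultimately show ?thesis
      unfolding ereal_integral_def P Q top by (cases "\<integral>\<^sup>+x. p (g x) \<partial>M") auto
  next
    case (real b)
    obtain a where a: "0 \<le> a" "(\<integral>\<^sup>+x. p (g x) \<partial>M) = ennreal a"
      using le by (cases "\<integral>\<^sup>+x. p (g x) \<partial>M") (auto simp: top_unique)
    obtain d where d: "0 \<le> d" "(\<integral>\<^sup>+x. q (g x) \<partial>M) = ennreal d"
      using eq unfolding a real
      by (cases "\<integral>\<^sup>+x. q (g x) \<partial>M") (auto simp: ennreal_plus[symmetric] simp del: ennreal_plus)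
    have "ennreal (a + b + max 0 (- c)) = ennreal (d + max 0 c)"
      using eq a d real by (simp add: ennreal_max_0')
    then have "a + b + max 0 (- c) = d + max 0 c"
      using a d real by (subst (asm) ennreal_inj) auto
    then have "a - d = c - b" using a d real by (simp add: max_def split: if_splits)
    then show ?thesis
      unfolding ereal_integral_def P Q a(2) d(2) real(2) using a d real by (simp add: enn2ereal_ennreal)
  qed
qed

text \<open>
  The logarithmic kernel subtracted from \<open>ln R\<close>. On a set of diameter at most \<open>R\<close> it is nonnegative, so
  that all double integrals of it exist and can be handled by monotonicity and Tonelli; its value on
  the diagonal makes measures with atoms have infinite integral.
\<close>
definition log_gap :: "real \<Rightarrow> complex \<Rightarrow> complex \<Rightarrow> ennreal" where
  "log_gap R z w = (if z = w then \<infinity> else ennreal (ln (R / cmod (z - w))))"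

lemma log_gap_commute: "log_gap R z w = log_gap R w z"
  by (simp add: log_gap_def norm_minus_commute)

lemma measurable_log_gap[measurable]:
  "(\<lambda>(z, w). log_gap R z w) \<in> borel_measurable (borel \<Otimes>\<^sub>M borel)"
  unfolding log_gap_def by measurable

lemma log_energy_eq:
  assumes M: "prob_space M" "sets M = sets borel" and S: "AE z in M. z \<in> S"
    and R: "R > 0" "\<And>z w. z \<in> S \<Longrightarrow> w \<in> S \<Longrightarrow> cmod (z - w) \<le> R"
  shows "log_energy M = ereal (ln R) - enn2ereal (\<integral>\<^sup>+z. \<integral>\<^sup>+w. log_gap R z w \<partial>M \<partial>M)"
proof -
  interpret prob_space M by fact
  have k[measurable]: "case_prod (log_gap R) \<in> borel_measurable (M \<Otimes>\<^sub>M M)"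
    using measurable_log_gap[of R] M(2) by (simp cong: measurable_cong_sets sets_pair_measure_cong)
  have [measurable]: "log_gap R z \<in> borel_measurable M" for z
    using measurable_Pair2[OF k, of z] M(2) sets_eq_imp_space_eq[OF M(2)] by simp
  have kernel: "log_kernel z w = ereal (ln R) - enn2ereal (log_gap R z w)" if "z \<in> S" "w \<in> S" for z w
  proof (cases "z = w")
    case False
    then have "0 < cmod (z - w)" by simp
    then have "0 \<le> ln (R / cmod (z - w))" "ln (R / cmod (z - w)) = ln R - ln (cmod (z - w))"
      using R(1) R(2)[OF that] by (auto simp: ln_div)
    then show ?thesis using False by (simp add: log_kernel_def log_gap_def enn2ereal_ennreal)
  qed (simp add: log_kernel_def log_gap_def)
  have inner: "ereal_integral M (\<lambda>w. log_kernel z w) = ereal (ln R) - enn2ereal (\<integral>\<^sup>+w. log_gap R z w \<partial>M)"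
    if "z \<in> S" for z
    using S by (intro ereal_integral_const_minus) (auto elim!: AE_mp simp: kernel[OF that])
  show ?thesis
    unfolding log_energy_def
    by (intro ereal_integral_const_minus) (use S in \<open>auto elim!: AE_mp simp: inner\<close>)
qed

lemma (in prob_space) exists_le_nn_integral:
  assumes [measurable]: "g \<in> borel_measurable M" and S: "AE x in M. x \<in> S"
  shows "\<exists>x\<in>S. g x \<le> (\<integral>\<^sup>+x. g x \<partial>M)"
proof (rule ccontr)
  assume "\<not> ?thesis"
  then have less: "AE x in M. (\<integral>\<^sup>+x. g x \<partial>M) < g x"
    using S by (auto simp: not_le elim: AE_mp)
  define c where "c = (\<integral>\<^sup>+x. g x \<partial>M)"
  have "c \<noteq> \<infinity>"
  proof
    assume "c = \<infinity>"
    then have "AE x in M. False" using less by (auto simp: c_def)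
    then show False by simp
  qed
  have "(\<integral>\<^sup>+x. (g x - c) \<partial>M) = (\<integral>\<^sup>+x. g x \<partial>M) - (\<integral>\<^sup>+x. c \<partial>M)"
    using less \<open>c \<noteq> \<infinity>\<close> by (intro nn_integral_diff) (auto simp: c_def emeasure_space_1 elim!: AE_mp)
  also have "\<dots> = 0" using \<open>c \<noteq> \<infinity>\<close> by (simp add: c_def emeasure_space_1)
  finally have "AE x in M. g x - c = 0" by (simp add: nn_integral_0_iff_AE)
  with less have "AE x in M. False"
    by (rule AE_mp[OF AE_conjI]) (auto simp: c_def diff_eq_0_iff_ennreal)
  then show False by simp
qed

text \<open>
  The average of the energy of \<open>N\<close> independent points, in an external field \<open>a\<close>, is the right-hand
  side. The points are chosen one at a time: a first point \<open>z\<close> is chosen well on average, and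
  its interaction \<open>2 * k z x\<close> with the others is added to the field for the remaining ones; this is why
  the statement carries a field. As the total stays finite and \<open>k\<close> is infinite on the diagonal,
  the chosen points are distinct.
\<close>
lemma (in prob_space) exists_low_energy_set:
  fixes k :: "'a \<Rightarrow> 'a \<Rightarrow> ennreal"
  assumes k[measurable]: "case_prod k \<in> borel_measurable (M \<Otimes>\<^sub>M M)"
    and sym: "\<And>x y. k x y = k y x" and diag: "\<And>x. k x x = \<infinity>"
    and S: "AE x in M. x \<in> S" and fin: "(\<integral>\<^sup>+x. \<integral>\<^sup>+y. k x y \<partial>M \<partial>M) < \<infinity>"
  shows "a \<in> borel_measurable M \<Longrightarrow> (\<integral>\<^sup>+x. a x \<partial>M) < \<infinity> \<Longrightarrow>
    \<exists>F. finite F \<and> F \<subseteq> S \<and> card F = N \<and>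
      (\<Sum>x\<in>F. a x) + (\<Sum>x\<in>F. \<Sum>y\<in>F - {x}. k x y)
        \<le> of_nat N * (\<integral>\<^sup>+x. a x \<partial>M) + of_nat (N * (N - 1)) * (\<integral>\<^sup>+x. \<integral>\<^sup>+y. k x y \<partial>M \<partial>M)"
proof (induction N arbitrary: a)
  case (Suc N)
  note [measurable] = Suc.prems(1)
  define D where "D = (\<integral>\<^sup>+x. \<integral>\<^sup>+y. k x y \<partial>M \<partial>M)"
  define A where "A = (\<integral>\<^sup>+x. a x \<partial>M)"
  define u where "u = (\<lambda>x. \<integral>\<^sup>+y. k x y \<partial>M)"
  have u[measurable]: "u \<in> borel_measurable M" unfolding u_def by measurable
  have km[measurable]: "k x \<in> borel_measurable M" if "x \<in> space M" for x
    using that by measurable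
  have ufin: "AE x in M. u x \<noteq> \<infinity>"
    using fin unfolding u_def by (intro nn_integral_PInf_AE) auto
  have S': "AE x in M. x \<in> {x \<in> S. x \<in> space M \<and> u x \<noteq> \<infinity>}"
    using S ufin AE_space by eventually_elim auto
  obtain z where z: "z \<in> S" "z \<in> space M" "u z \<noteq> \<infinity>"
    and le: "a z + 2 * of_nat N * u z \<le> (\<integral>\<^sup>+x. a x + 2 * of_nat N * u x \<partial>M)"
    using exists_le_nn_integral[OF _ S', of "\<lambda>x. a x + 2 * of_nat N * u x"] by auto
  have le: "a z + 2 * of_nat N * u z \<le> A + 2 * of_nat N * D"
    using le by (simp add: nn_integral_add nn_integral_cmult A_def D_def u_def)
  have int: "(\<integral>\<^sup>+x. a x + 2 * k z x \<partial>M) = A + 2 * u z"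
    using z km[OF z(2)] by (simp add: nn_integral_add nn_integral_cmult A_def u_def)
  have "(\<integral>\<^sup>+x. a x + 2 * k z x \<partial>M) < \<infinity>"
    unfolding int using Suc.prems(2) z(3)
    by (simp add: A_def ennreal_mult_less_top less_top)
  then obtain F where F: "finite F" "F \<subseteq> S" "card F = N"
    and Fle: "(\<Sum>x\<in>F. a x + 2 * k z x) + (\<Sum>x\<in>F. \<Sum>y\<in>F - {x}. k x y)
      \<le> of_nat N * (A + 2 * u z) + of_nat (N * (N - 1)) * D"
    using Suc.IH[of "\<lambda>x. a x + 2 * k z x"] km[OF z(2)] unfolding int D_def by auto
  have "z \<notin> F"
  proof
    assume "z \<in> F"
    then have "(\<Sum>x\<in>F. a x + 2 * k z x) = \<infinity>"
      using F diag by (subst sum.remove[of _ z]) (auto simp: ennreal_mult_top)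
    then have "of_nat N * (A + 2 * u z) + of_nat (N * (N - 1)) * D = \<infinity>"
      using Fle by (simp add: top_unique)
    then show False using Suc.prems(2) z(3) fin
      by (auto simp: ennreal_mult_eq_top_iff A_def D_def)
  qed
  have "(\<Sum>x\<in>insert z F. a x) + (\<Sum>x\<in>insert z F. \<Sum>y\<in>insert z F - {x}. k x y) =
      a z + ((\<Sum>x\<in>F. a x + 2 * k z x) + (\<Sum>x\<in>F. \<Sum>y\<in>F - {x}. k x y))"
    unfolding sum.off_diagonal_insert[OF F(1) \<open>z \<notin> F\<close>]
    using F(1) \<open>z \<notin> F\<close> by (simp add: sum.distrib sym[of _ z] mult_2 ac_simps)
  also have "\<dots> \<le> a z + (of_nat N * (A + 2 * u z) + of_nat (N * (N - 1)) * D)"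
    using Fle by (rule add_left_mono)
  also have "\<dots> = (a z + 2 * of_nat N * u z) + of_nat N * A + of_nat (N * (N - 1)) * D"
    by (simp add: algebra_simps)
  also have "\<dots> \<le> (A + 2 * of_nat N * D) + of_nat N * A + of_nat (N * (N - 1)) * D"
    using le by (intro add_right_mono)
  also have "\<dots> = of_nat (Suc N) * A + (of_nat (2 * N) + of_nat (N * (N - 1))) * D"
    by (simp add: algebra_simps)
  also have "of_nat (2 * N) + of_nat (N * (N - 1)) = (of_nat (Suc N * (Suc N - 1)) :: ennreal)"
    unfolding of_nat_add[symmetric] by (intro arg_cong[of _ _ of_nat]) (cases N; simp)
  finally show ?case
    using F z \<open>z \<notin> F\<close> by (intro exI[of _ "insert z F"]) (auto simp: A_def D_def)
qed (auto intro!: exI[of _ "{}"])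

section \<open>Bounds for the capacity from energy bounds\<close>

text \<open>
  The complement of the support is a union of open null sets, and by the Lindelof property countably
  many of them suffice.
\<close>
lemma AE_measure_support:
  fixes M :: "'a::second_countable_topology measure"
  assumes M: "sets M = sets borel"
  shows "AE x in M. x \<in> measure_support M"
proof -
  define U where "U = {u. open u \<and> emeasure M u = 0}"
  obtain V where V: "V \<subseteq> U" "countable V" "\<Union>V = \<Union>U"
    using Lindelof[of U] by (auto simp: U_def)
  have "AE x in M. \<forall>u\<in>V. x \<notin> u"
    using V by (subst AE_ball_countable) (auto simp: U_def M intro!: AE_not_in null_setsI)
  then show ?thesis
    by eventually_elim (use V(3) in \<open>auto simp: measure_support_def U_def zero_less_iff_neq_zero\<close>)
qed

lemma closed_measure_support: "closed (measure_support M)"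
proof -
  have "- measure_support M = \<Union>{u. open u \<and> emeasure M u = 0}"
    by (auto simp: measure_support_def zero_less_iff_neq_zero)
  then show ?thesis by (simp add: closed_def open_Union)
qed

lemma measure_support_subset:
  assumes M: "sets M = sets borel" and X: "closed X" and AE: "AE x in M. x \<in> X"
  shows "measure_support M \<subseteq> X"
proof
  fix x assume x: "x \<in> measure_support M"
  show "x \<in> X"
  proof (rule ccontr)
    assume "x \<notin> X"
    then have "0 < emeasure M (- X)" using x X by (auto simp: measure_support_def closed_def)
    moreover have "emeasure M (- X) = 0"
      using AE X M by (subst (asm) AE_iff_measurable[where N = "- X"]) (auto simp: sets_eq_imp_space_eq[OF M])
    ultimately show False by simp
  qed
qed

lemma exp_ereal_mono: "x \<le> y \<Longrightarrow> exp_ereal x \<le> exp_ereal y"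
  by (cases x; cases y) (auto simp: exp_ereal_def ennreal_leI)

lemma log_capacity_le:
  assumes "\<And>M. prob_space M \<Longrightarrow> sets M = sets borel \<Longrightarrow> AE z in M. z \<in> X \<Longrightarrow> log_energy M \<noteq> - \<infinity> \<Longrightarrow>
    log_energy M \<le> ereal b"
  shows "log_capacity X \<le> ennreal (exp b)"
  unfolding log_capacity_def
proof (rule SUP_least, clarify)
  fix M :: "complex measure"
  assume M: "sets M = sets borel" "prob_space M" "measure_support M \<subseteq> X"
  have "AE z in M. z \<in> X" using AE_measure_support[OF M(1)] M(3) by (auto elim!: AE_mp)
  with assms[OF M(2,1)] exp_ereal_mono[of "log_energy M" "ereal b"]
  show "exp_ereal (log_energy M) \<le> ennreal (exp b)"
    by (cases "log_energy M = - \<infinity>") (auto simp: exp_ereal_def)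
qed

lemma log_capacity_ge:
  assumes "compact X" "prob_space M" "sets M = sets borel" "AE z in M. z \<in> X" "ereal b \<le> log_energy M"
  shows "ennreal (exp b) \<le> log_capacity X"
proof -
  have sub: "measure_support M \<subseteq> X"
    using assms by (intro measure_support_subset) (auto intro: compact_imp_closed)
  then have "compact (measure_support M)"
    using closed_measure_support[of M] \<open>compact X\<close> by (metis compact_Int_closed inf.absorb_iff2)
  then have "exp_ereal (log_energy M) \<le> log_capacity X"
    unfolding log_capacity_def using assms sub by (intro SUP_upper) auto
  moreover have "ennreal (exp b) \<le> exp_ereal (log_energy M)"
    using exp_ereal_mono[OF assms(5)] by (simp add: exp_ereal_def)
  ultimately show ?thesis by simp
qed

lemma log_capacity_mono: "X \<subseteq> Y \<Longrightarrow> log_capacity X \<le> log_capacity Y"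
  unfolding log_capacity_def by (intro SUP_subset_mono) auto

text \<open>
  This bound is the exact capacity of the region. For each \<open>N\<close>, well-chosen points have a mean mutual
  energy at least that of the measure, while the polynomial bound limits it up to an
  error of order \<open>ln N / N\<close>.
\<close>
lemma log_capacity_joukowski_le:
  assumes a: "a > 0" and r: "1 \<le> r" and X: "X \<subseteq> joukowski_image c a r"
  shows "log_capacity X \<le> ennreal (a * r)"
proof -
  \<comment> \<open>Any bound for the diameter will do, as \<open>ln R\<close> cancels in the end.\<close>
  define R where "R = 2 * a * (r + 1)"
  have R: "R > 0" "\<And>z w. z \<in> joukowski_image c a r \<Longrightarrow> w \<in> joukowski_image c a r \<Longrightarrow> cmod (z - w) \<le> R"
    using a r joukowski_image_diameter[OF a] by (auto simp: R_def)
  have "log_capacity X \<le> ennreal (exp (ln (a * r)))"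
  proof (rule log_capacity_le)
    fix M :: "complex measure"
    assume M: "prob_space M" "sets M = sets borel" "AE z in M. z \<in> X" "log_energy M \<noteq> - \<infinity>"
    interpret prob_space M by fact
    have AE: "AE z in M. z \<in> joukowski_image c a r" using M(3) X by (auto elim!: AE_mp)
    have [measurable]: "case_prod (log_gap R) \<in> borel_measurable (M \<Otimes>\<^sub>M M)"
      using measurable_log_gap[of R] M(2) by (simp cong: measurable_cong_sets sets_pair_measure_cong)
    define D where "D = (\<integral>\<^sup>+z. \<integral>\<^sup>+w. log_gap R z w \<partial>M \<partial>M)"
    have energy: "log_energy M = ereal (ln R) - enn2ereal D"
      unfolding D_def by (rule log_energy_eq[OF M(1,2) AE R])
    with M(4) obtain d where d: "0 \<le> d" "D = ennreal d"
      by (cases D) auto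
    have bound: "ln R - d \<le> ln (a * r) + 2 * ln (2 * real N) / (real N - 1)" if N: "N \<ge> 2" for N
    proof -
      obtain F where F: "finite F" "F \<subseteq> joukowski_image c a r" "card F = N"
        and le: "(\<Sum>x\<in>F. \<Sum>y\<in>F - {x}. log_gap R x y) \<le> of_nat (N * (N - 1)) * D"
        using exists_low_energy_set[of "log_gap R" "joukowski_image c a r" "\<lambda>_. 0" N] AE d(2)
        by (auto simp: log_gap_commute log_gap_def D_def)
      have gap: "log_gap R x y = ennreal (ln R - ln (cmod (x - y)))" "0 \<le> ln R - ln (cmod (x - y))"
        if "x \<in> F" "y \<in> F - {x}" for x y
      proof -
        have "0 < cmod (x - y)" "cmod (x - y) \<le> R" using that F R(2)[of x y] by auto
        then show "log_gap R x y = ennreal (ln R - ln (cmod (x - y)))" "0 \<le> ln R - ln (cmod (x - y))"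
          using R(1) by (auto simp: log_gap_def ln_div)
      qed
      have "(\<Sum>x\<in>F. \<Sum>y\<in>F - {x}. log_gap R x y) = (\<Sum>x\<in>F. ennreal (\<Sum>y\<in>F - {x}. ln R - ln (cmod (x - y))))"
      proof (rule sum.cong[OF refl])
        fix x assume "x \<in> F"
        then have "(\<Sum>y\<in>F - {x}. log_gap R x y) = (\<Sum>y\<in>F - {x}. ennreal (ln R - ln (cmod (x - y))))"
          using gap(1) by (intro sum.cong) auto
        also have "\<dots> = ennreal (\<Sum>y\<in>F - {x}. ln R - ln (cmod (x - y)))"
          using gap(2)[OF \<open>x \<in> F\<close>] by (rule sum_ennreal)
        finally show "(\<Sum>y\<in>F - {x}. log_gap R x y) = ennreal (\<Sum>y\<in>F - {x}. ln R - ln (cmod (x - y)))" .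
      qed
      also have "\<dots> = ennreal (\<Sum>x\<in>F. \<Sum>y\<in>F - {x}. ln R - ln (cmod (x - y)))"
        by (intro sum_ennreal sum_nonneg gap(2))
      finally have "ennreal (\<Sum>x\<in>F. \<Sum>y\<in>F - {x}. ln R - ln (cmod (x - y))) \<le> ennreal (real (N * (N - 1)) * d)"
        using le d by (simp add: ennreal_mult ennreal_of_nat_eq_real_of_nat)
      then have "(\<Sum>x\<in>F. \<Sum>y\<in>F - {x}. ln R - ln (cmod (x - y))) \<le> real (N * (N - 1)) * d"
        using d by (simp add: ennreal_le_iff)
      moreover have "(\<Sum>x\<in>F. \<Sum>y\<in>F - {x}. ln R - ln (cmod (x - y))) =
          real N * (real N - 1) * ln R - (\<Sum>x\<in>F. \<Sum>y\<in>F - {x}. ln (cmod (x - y)))"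
        using F N by (simp add: sum_subtractf of_nat_diff)
      moreover have "real (N * (N - 1)) = real N * (real N - 1)" using N by (simp add: of_nat_diff)
      moreover have "(\<Sum>x\<in>F. \<Sum>y\<in>F - {x}. ln (cmod (x - y)))
          \<le> 2 * real N * ln (2 * real N) + real N * (real N - 1) * ln (a * r)"
        using N by (intro off_diagonal_log_sum_le[OF a r F(1,2,3)]) auto
      ultimately have "real N * (real N - 1) * (ln R - d) \<le>
          real N * (2 * ln (2 * real N) + (real N - 1) * ln (a * r))"
        by (simp add: algebra_simps)
      then have "(real N - 1) * (ln R - d) \<le> 2 * ln (2 * real N) + (real N - 1) * ln (a * r)"
        using N by (simp add: mult.assoc)
      then show ?thesis using N by (simp add: field_simps)
    qed
    have "(\<lambda>N. ln (a * r) + 2 * ln (2 * real N) / (real N - 1)) \<longlonglongrightarrow> ln (a * r) + 0"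
      by (intro tendsto_add tendsto_const) real_asymp
    then have "ln R - d \<le> ln (a * r)"
      using bound by (intro LIMSEQ_le_const[of _ "ln (a * r)"]) (auto intro!: exI[of _ 2])
    then show "log_energy M \<le> ereal (ln (a * r))"
      using d by (simp add: energy enn2ereal_ennreal)
  qed
  then show ?thesis using a r by simp
qed

lemma log_capacity_union_translates_le:
  assumes E: "E \<subseteq> {z. cmod z \<le> 1 / 4}" and n: "n \<ge> 1"
  shows "log_capacity (union_translates E n) \<le> ennreal (real n / 4 * exp (1 / sqrt (real n)))"
proof -
  have "union_translates E n \<subseteq> joukowski_image (of_real ((real n + 1) / 2)) (real n / 4) (exp (1 / sqrt (real n)))"
  proof
    fix z assume "z \<in> union_translates E n"
    then obtain j a where j: "j \<in> {1..n}" "a \<in> E" "z = a + of_nat j"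
      unfolding union_translates_def by blast
    \<comment> \<open>The integers from 1 to \<open>n\<close> lie on the segment from \<open>1/2\<close> to \<open>n + 1/2\<close>, which has length \<open>n\<close>.\<close>
    let ?c = "(real n + 1) / 2"
    have eq: "of_real ?c + of_real (real j - ?c) = complex_of_nat j"
      unfolding of_real_add[symmetric] by simp
    have "z \<in> joukowski_image (of_real ?c) (real n / 4) (exp (sqrt ((1 / 4) / (real n / 4))))"
    proof (rule near_segment_in_joukowski_image)
      show "\<bar>real j - ?c\<bar> \<le> 2 * (real n / 4)" using j by (auto simp: abs_le_iff field_simps)
      show "cmod (z - (of_real ?c + of_real (real j - ?c))) \<le> 1 / 4" 
        unfolding eq using j E by auto
    qed (use n in auto)
    then show "z \<in> joukowski_image (of_real ?c) (real n / 4) (exp (1 / sqrt (real n)))"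
      by (simp add: real_sqrt_divide)
  qed
  then show ?thesis using n by (intro log_capacity_joukowski_le) auto
qed

lemma log_capacity_segment_le:
  assumes n: "n \<ge> 1"
  shows "log_capacity (complex_of_real ` {0..real n}) \<le> ennreal (real n / 4)"
proof -
  have "complex_of_real ` {0..real n} \<subseteq> joukowski_image (of_real (real n / 2)) (real n / 4) 1"
  proof clarify
    fix x assume x: "x \<in> {0..real n}"
    have "complex_of_real x \<in> joukowski_image (of_real (real n / 2)) (real n / 4) (exp (sqrt (0 / (real n / 4))))"
    proof (rule near_segment_in_joukowski_image)
      show "\<bar>x - real n / 2\<bar> \<le> 2 * (real n / 4)" using x by (subst abs_le_iff) auto
      have "of_real (real n / 2) + of_real (x - real n / 2) = complex_of_real x"
        unfolding of_real_add[symmetric] by simp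
      then show "cmod (of_real x - (of_real (real n / 2) + of_real (x - real n / 2))) \<le> 0" by simp
    qed (use n in auto)
    then show "complex_of_real x \<in> joukowski_image (of_real (real n / 2)) (real n / 4) 1" by simp
  qed
  from log_capacity_joukowski_le[OF _ _ this] show ?thesis using n by simp
qed

section \<open>Zeros of the Chebyshev polynomials\<close>

text \<open>
  The zeros of the Chebyshev polynomial of degree \<open>n\<close> are the cosines of these angles for \<open>k < n\<close>.
\<close>
definition node_angle :: "nat \<Rightarrow> nat \<Rightarrow> real" where
  "node_angle n k = (2 * real k + 1) * pi / (2 * real n)"

lemma node_angle_bounds: "k < n \<Longrightarrow> 0 < node_angle n k \<and> node_angle n k < pi"
  by (auto simp: node_angle_def divide_simps)

lemma node_angle_diff: "node_angle n k - node_angle n l = (real k - real l) * pi / real n"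
  by (simp add: node_angle_def divide_simps) (simp add: algebra_simps)

lemma inj_on_cos_node_angle: "inj_on (\<lambda>k. cos (node_angle n k)) {..<n}"
proof (rule inj_onI)
  fix k l assume k: "k \<in> {..<n}" and l: "l \<in> {..<n}" and eq: "cos (node_angle n k) = cos (node_angle n l)"
  have "node_angle n k = node_angle n l"
    using node_angle_bounds[of k n] node_angle_bounds[of l n] k l eq
    by - (rule cos_inj_pi, auto)
  then have "(real k - real l) * pi / real n = 0"
    using node_angle_diff[of n k l] by simp
  then show "k = l" using k by simp
qed

text \<open>
  The product is the absolute value of the derivative of the Dickson polynomial \<open>P\<close> at its zero
  \<open>2 cos \<theta>\<close>. Differentiating \<open>P (2 cos t) = 2 cos (n t)\<close> shows that it equals \<open>n / sin \<theta>\<close>.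
\<close>
lemma node_product_ge:
  assumes k: "k < n"
  shows "real n \<le> (\<Prod>l\<in>{..<n} - {k}. \<bar>2 * cos (node_angle n k) - 2 * cos (node_angle n l)\<bar>)"
proof -
  define t where "t = (\<lambda>l. 2 * cos (node_angle n l))"
  have inj: "inj_on t {..<n}"
    using inj_on_cos_node_angle[of n] by (auto simp: inj_on_def t_def)
  define Q where "Q = (\<Prod>l\<in>{..<n} - {k}. [:- t l, 1:])"
  have deg: "degree (\<Prod>l\<in>{..<n}. [:- t l, 1:]) = n"
    by (subst degree_prod_eq_sum_degree) auto
  have mon: "coeff (\<Prod>l\<in>{..<n}. [:- t l, 1:]) n = 1"
    using deg lead_coeff_prod[of "\<lambda>l. [:- t l, 1:]" "{..<n}"] by simp
  have root: "poly (dickson n) (t l) = 0" if "l < n" for l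
  proof -
    have "real n * node_angle n l = real l * pi + pi / 2"
      using that by (simp add: node_angle_def field_simps)
    then show ?thesis by (simp add: t_def poly_dickson_cos cos_add sin_npi)
  qed
  have eq: "dickson n = (\<Prod>l\<in>{..<n}. [:- t l, 1:])"
  proof (rule poly_eqI_degree_lead_coeff[where A = "t ` {..<n}" and n = n])
    show "n \<le> card (t ` {..<n})" using inj by (simp add: card_image)
    show "coeff (dickson n) n = coeff (\<Prod>l\<in>{..<n}. [:- t l, 1:]) n" 
      using coeff_dickson[of n] k mon by simp
  qed (use deg root degree_dickson_le in \<open>auto simp: poly_prod\<close>)
  also have "\<dots> = [:- t k, 1:] * Q"
    unfolding Q_def using k by (subst prod.remove[of _ k]) auto
  finally have "poly (pderiv (dickson n)) (t k) = poly (pderiv ([:- t k, 1:] * Q)) (t k)"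
    by (rule arg_cong)
  also have "\<dots> = poly Q (t k)"
    by (subst pderiv_mult) (simp add: pderiv_pCons)
  finally have "poly (pderiv (dickson n)) (t k) = poly Q (t k)" .
  moreover have "\<bar>poly (pderiv (dickson n)) (t k)\<bar> * sin (node_angle n k) = real n"
  proof -
    let ?\<theta> = "node_angle n k"
    have "((\<lambda>x. poly (dickson n) (2 * cos x)) has_real_derivative
        poly (pderiv (dickson n)) (t k) * (- 2 * sin ?\<theta>)) (at ?\<theta>)"
      unfolding t_def by (auto intro!: derivative_eq_intros DERIV_chain2[OF poly_DERIV])
    moreover have "((\<lambda>x. poly (dickson n) (2 * cos x)) has_real_derivative
        - 2 * real n * sin (real n * ?\<theta>)) (at ?\<theta>)"
      unfolding poly_dickson_cos by (auto intro!: derivative_eq_intros)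
    ultimately have *: "poly (pderiv (dickson n)) (t k) * (- 2 * sin ?\<theta>) = - 2 * real n * sin (real n * ?\<theta>)"
      by (rule DERIV_unique)
    have "real n * ?\<theta> = real k * pi + pi / 2"
      using k by (simp add: node_angle_def field_simps)
    then have "\<bar>sin (real n * ?\<theta>)\<bar> = 1"
      by (simp add: sin_add cos_npi)
    moreover have "sin ?\<theta> > 0" using node_angle_bounds[OF k] by (intro sin_gt_zero) auto
    ultimately show ?thesis using arg_cong[OF *, of abs] by (simp add: abs_mult)
  qed
  moreover have "0 < sin (node_angle n k)" "sin (node_angle n k) \<le> 1"
    using node_angle_bounds[OF k] by (auto intro!: sin_gt_zero)
  ultimately have "real n \<le> \<bar>poly Q (t k)\<bar>"
    by (metis abs_ge_zero mult_left_le)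
  also have "\<bar>poly Q (t k)\<bar> = (\<Prod>l\<in>{..<n} - {k}. \<bar>t k - t l\<bar>)"
    by (simp add: Q_def poly_prod abs_prod)
  finally show ?thesis by (simp add: t_def)
qed

text \<open>
  Jordan's inequality: the concave sine lies above its chord on \<open>[0, pi / 2]\<close>.
\<close>
lemma sin_ge_two_div_pi:
  assumes "0 \<le> t" "t \<le> pi / 2"
  shows "2 / pi * t \<le> sin t"
proof -
  have "convex_on {0..pi / 2} (\<lambda>x. - sin x)"
  proof (rule f''_ge0_imp_convex)
    show "((\<lambda>x. - sin x) has_real_derivative - cos x) (at x)" for x :: real
      by (auto intro!: derivative_eq_intros)
    show "((\<lambda>x. - cos x) has_real_derivative sin x) (at x)" for x :: real
      by (auto intro!: derivative_eq_intros)
  qed (auto intro: sin_ge_zero)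
  from convex_onD[OF this, of "2 * t / pi" 0 "pi / 2"] assms show ?thesis
    by (simp add: field_simps)
qed

text \<open>
  For \<open>s \<le> t\<close> the difference is \<open>2 sin ((t - s) / 2) sin ((t + s) / 2)\<close>. The second factor is at
  least the first, because \<open>(t + s) / 2\<close> has at least the distance \<open>(t - s) / 2\<close> from both 0 and \<open>pi\<close>.
\<close>
lemma cos_diff_ge:
  assumes "0 \<le> s" "s \<le> pi" "0 \<le> t" "t \<le> pi"
  shows "2 * ((s - t) / pi)\<^sup>2 \<le> \<bar>cos s - cos t\<bar>"
proof -
  have *: "2 * ((s - t) / pi)\<^sup>2 \<le> cos s - cos t" if "0 \<le> s" "s \<le> t" "t \<le> pi" for s t
  proof -
    have 1: "2 / pi * ((t - s) / 2) \<le> sin ((t - s) / 2)"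
      using that by (intro sin_ge_two_div_pi) auto
    have 2: "sin ((t - s) / 2) \<le> sin ((t + s) / 2)"
    proof (cases "(t + s) / 2 \<le> pi / 2")
      case True
      then show ?thesis using that by (intro sin_monotone_2pi_le) auto
    next
      case False
      have "sin ((t - s) / 2) \<le> sin (pi - (t + s) / 2)"
        using that False by (intro sin_monotone_2pi_le) (auto simp: field_simps)
      then show ?thesis by simp
    qed
    have "((s - t) / pi)\<^sup>2 = (2 / pi * ((t - s) / 2)) * (2 / pi * ((t - s) / 2))"
      by (simp add: power2_eq_square field_simps)
    also have "\<dots> \<le> sin ((t - s) / 2) * sin ((t + s) / 2)"
      using 1 2 that by (intro mult_mono) (auto intro!: sin_ge_zero)
    also have "2 * \<dots> = cos s - cos t"
      by (simp add: cos_diff_cos algebra_simps)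
    finally show ?thesis by simp
  qed
  have "((s - t) / pi)\<^sup>2 = ((t - s) / pi)\<^sup>2" by (simp add: power2_eq_square field_simps)
  then show ?thesis using *[of s t] *[of t s] assms by (cases "s \<le> t") auto
qed

text \<open>
  Each term is at most \<open>sqrt n\<close> times an increment of the arctangent, by the mean value theorem.
\<close>
lemma sum_recip_square_le:
  assumes n: "n > 0"
  shows "(\<Sum>m=1..N. 1 / (1 + (real m)\<^sup>2 / n)) \<le> sqrt n * arctan (real N / sqrt n)"
proof (induction N)
  case (Suc N)
  define a b where "a = real N / sqrt n" and "b = real (Suc N) / sqrt n"
  have ab: "0 \<le> a" "a < b" using n by (auto simp: a_def b_def field_simps)
  obtain c where c: "a < c" "c < b" "arctan b - arctan a = (b - a) * inverse (1 + c\<^sup>2)"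
    using MVT2[of a b arctan "\<lambda>x. inverse (1 + x\<^sup>2)"] ab DERIV_arctan by auto
  have "1 / (1 + b\<^sup>2) \<le> inverse (1 + c\<^sup>2)"
    using c ab by (simp add: inverse_eq_divide power_mono divide_left_mono add_pos_nonneg)
  moreover have "b - a = 1 / sqrt n" by (simp add: a_def b_def add_divide_distrib)
  ultimately have "1 / (1 + b\<^sup>2) \<le> sqrt n * (arctan b - arctan a)"
    using c n by simp
  moreover have "b\<^sup>2 = (real (Suc N))\<^sup>2 / n" using n by (simp add: b_def power_divide)
  ultimately have "1 / (1 + (real (Suc N))\<^sup>2 / n) \<le> sqrt n * arctan b - sqrt n * arctan a"
    by (simp only: right_diff_distrib)
  with Suc show ?case by (simp add: a_def b_def)
qed auto

lemma node_row_sum_le: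
  assumes k: "k < n"
  shows "(\<Sum>l<n. 1 / (1 + (real k - real l)\<^sup>2 / real n)) \<le> 1 + pi * sqrt (real n)"
proof -
  define h where "h = (\<lambda>m. 1 / (1 + (real m)\<^sup>2 / real n))"
  have side: "(\<Sum>m=1..N. h m) \<le> pi / 2 * sqrt (real n)" for N
  proof -
    have "(\<Sum>m=1..N. h m) \<le> sqrt (real n) * arctan (real N / sqrt (real n))"
      unfolding h_def using k by (intro sum_recip_square_le) auto
    also have "\<dots> \<le> sqrt (real n) * (pi / 2)"
      using arctan_ubound by (intro mult_left_mono) (auto intro: less_imp_le)
    finally show ?thesis by (simp add: mult.commute)
  qed
  have split: "{..<n} = insert k ({..<k} \<union> {k<..<n})" using k by auto
  have "(\<Sum>l<n. 1 / (1 + (real k - real l)\<^sup>2 / real n)) =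
      1 + ((\<Sum>l<k. 1 / (1 + (real k - real l)\<^sup>2 / real n)) + (\<Sum>l\<in>{k<..<n}. 1 / (1 + (real k - real l)\<^sup>2 / real n)))"
    unfolding split by (subst sum.insert) (auto intro!: sum.union_disjoint)
  also have "(\<Sum>l<k. 1 / (1 + (real k - real l)\<^sup>2 / real n)) = (\<Sum>m=1..k. h m)"
    by (rule sum.reindex_bij_witness[of _ "\<lambda>m. k - m" "\<lambda>l. k - l"]) (auto simp: h_def of_nat_diff)
  also have "(\<Sum>l\<in>{k<..<n}. 1 / (1 + (real k - real l)\<^sup>2 / real n)) = (\<Sum>m=1..n - 1 - k. h m)"
    by (rule sum.reindex_bij_witness[of _ "\<lambda>m. k + m" "\<lambda>l. l - k"])
      (auto simp: h_def of_nat_diff power2_commute)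
  also have "1 + ((\<Sum>m=1..k. h m) + (\<Sum>m=1..n - 1 - k. h m)) \<le> 1 + (pi / 2 * sqrt (real n) + pi / 2 * sqrt (real n))"
    by (intro add_left_mono add_mono side)
  finally show ?thesis by simp
qed

text \<open>
  The Chebyshev nodes of the segment \<open>[0, n]\<close>.
\<close>
definition cheb_node :: "nat \<Rightarrow> nat \<Rightarrow> real" where
  "cheb_node n k = real n / 2 * (1 + cos (node_angle n k))"

lemma cheb_node_bounds:
  assumes "k < n"
  shows "0 < cheb_node n k" "cheb_node n k < real n"
proof -
  have "cos pi < cos (node_angle n k)" "cos (node_angle n k) < cos 0"
    using node_angle_bounds[OF assms] by (intro cos_monotone_0_pi; simp)+
  then show "0 < cheb_node n k" "cheb_node n k < real n"
    using assms by (auto simp: cheb_node_def)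
qed

lemma cheb_node_eq_iff: "k < n \<Longrightarrow> l < n \<Longrightarrow> cheb_node n k = cheb_node n l \<longleftrightarrow> k = l"
  using inj_on_cos_node_angle[of n] by (auto simp: cheb_node_def inj_on_def)

lemma cheb_node_diff:
  "cheb_node n k - cheb_node n l = real n / 4 * (2 * cos (node_angle n k) - 2 * cos (node_angle n l))"
  by (simp add: cheb_node_def right_diff_distrib distrib_left)

text \<open>
  Scaling the nodes from \<open>[-2, 2]\<close> to \<open>[0, n]\<close> contributes \<open>ln (n / 4)\<close> for each of the \<open>n - 1\<close> factors; the
  lower bound \<open>n\<close> for the product makes up for the missing one.
\<close>
lemma sum_log_cheb_node_dist_ge:
  assumes k: "k < n"
  shows "real n * ln (real n / 4) \<le> (\<Sum>l\<in>{..<n} - {k}. ln \<bar>cheb_node n k - cheb_node n l\<bar>)"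
proof -
  define y where "y = (\<lambda>l. \<bar>2 * cos (node_angle n k) - 2 * cos (node_angle n l)\<bar>)"
  have n: "0 < real n" using k by simp
  have y: "0 < y l" if "l \<in> {..<n} - {k}" for l
    using cheb_node_eq_iff[OF k, of l] that by (auto simp: y_def cheb_node_def)
  have "ln (real n / 4) = ln (real n) - ln 4" using n by (simp add: ln_div)
  moreover have "0 \<le> ln (4 :: real)" by simp
  ultimately have "real n * ln (real n / 4) \<le> (real n - 1) * ln (real n / 4) + ln (real n)"
    by (simp add: left_diff_distrib)
  also have "ln (real n) \<le> ln (\<Prod>l\<in>{..<n} - {k}. y l)"
    using node_product_ge[OF k] n by (intro ln_mono) (auto simp: y_def)
  also have "\<dots> = (\<Sum>l\<in>{..<n} - {k}. ln (y l))"
    using y by (intro ln_prod) (auto, metis less_irrefl)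
  also have "(real n - 1) * ln (real n / 4) + \<dots> = (\<Sum>l\<in>{..<n} - {k}. ln (real n / 4) + ln (y l))"
    using k by (simp add: sum.distrib of_nat_diff)
  also have "\<dots> = (\<Sum>l\<in>{..<n} - {k}. ln \<bar>cheb_node n k - cheb_node n l\<bar>)"
  proof (rule sum.cong[OF refl])
    fix l assume "l \<in> {..<n} - {k}"
    then have "ln (real n / 4) + ln (y l) = ln (real n / 4 * y l)"
      using y[of l] n by (subst ln_mult) auto
    also have "real n / 4 * y l = \<bar>cheb_node n k - cheb_node n l\<bar>"
      unfolding cheb_node_diff abs_mult y_def by simp
    finally show "ln (real n / 4) + ln (y l) = ln \<bar>cheb_node n k - cheb_node n l\<bar>" .
  qed
  finally show ?thesis by simp
qed

lemma sum_recip_cheb_node_dist_le: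
  assumes k: "k < n"
  shows "(\<Sum>l<n. 1 / (1 + \<bar>cheb_node n k - cheb_node n l\<bar>)) \<le> 1 + pi * sqrt (real n)"
proof -
  have "1 / (1 + \<bar>cheb_node n k - cheb_node n l\<bar>) \<le> 1 / (1 + (real k - real l)\<^sup>2 / real n)" if l: "l < n" for l
  proof -
    have "(real k - real l)\<^sup>2 / real n = real n / 2 * (2 * ((node_angle n k - node_angle n l) / pi)\<^sup>2)"
      using k by (simp add: node_angle_diff power2_eq_square)
    also have "\<dots> \<le> real n / 2 * \<bar>cos (node_angle n k) - cos (node_angle n l)\<bar>"
      using node_angle_bounds[OF k] node_angle_bounds[OF l]
      by (intro mult_left_mono cos_diff_ge) auto
    also have "\<dots> = \<bar>cheb_node n k - cheb_node n l\<bar>"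
      unfolding cheb_node_diff right_diff_distrib[symmetric] abs_mult by simp
    finally show ?thesis
      by (intro divide_left_mono) (auto intro!: mult_pos_pos add_pos_nonneg)
  qed
  then have "(\<Sum>l<n. 1 / (1 + \<bar>cheb_node n k - cheb_node n l\<bar>)) \<le> (\<Sum>l<n. 1 / (1 + (real k - real l)\<^sup>2 / real n))"
    by (intro sum_mono) auto
  also have "\<dots> \<le> 1 + pi * sqrt (real n)" by (rule node_row_sum_le[OF k])
  finally show ?thesis .
qed

section \<open>Averages of translates of a measure\<close>

text \<open>
  The measure is the distribution of \<open>z + j k\<close> for \<open>k\<close> uniform on \<open>{..<n}\<close> and an independent \<open>z\<close>
  distributed according to \<open>\<nu>\<close>.
\<close>
lemma exists_average_of_translates:
  fixes \<nu> :: "complex measure" and j :: "nat \<Rightarrow> complex"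
  assumes nu: "prob_space \<nu>" "sets \<nu> = sets borel" and n: "n > 0"
  obtains \<mu> where "prob_space \<mu>" "sets \<mu> = sets borel"
    "\<And>f. f \<in> borel_measurable borel \<Longrightarrow>
      (\<integral>\<^sup>+z. f z \<partial>\<mu>) = (\<Sum>k<n. \<integral>\<^sup>+z. f (z + j k) \<partial>\<nu>) / of_nat n"
proof
  interpret prob_space \<nu> by fact
  let ?U = "measure_pmf (pmf_of_set {..<n})"
  define T where "T = (\<lambda>(k, z). z + j k)"
  interpret P: pair_prob_space ?U \<nu> ..
  have [measurable]: "(\<lambda>x. x) \<in> borel_measurable \<nu>" using nu(2) by (simp cong: measurable_cong_sets)
  have T[measurable]: "T \<in> borel_measurable (?U \<Otimes>\<^sub>M \<nu>)"
    unfolding T_def split_beta' 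
  proof (rule borel_measurable_add)
    show "(\<lambda>x. snd x) \<in> borel_measurable (?U \<Otimes>\<^sub>M \<nu>)"
      using measurable_snd[of ?U \<nu>] nu(2) by (simp cong: measurable_cong_sets)
    show "(\<lambda>x. j (fst x)) \<in> borel_measurable (?U \<Otimes>\<^sub>M \<nu>)"
      by (rule measurable_compose[OF measurable_fst]) simp
  qed
  define \<mu> where "\<mu> = distr (?U \<Otimes>\<^sub>M \<nu>) borel T"
  show "prob_space \<mu>" unfolding \<mu>_def by (rule P.prob_space_distr) simp
  show "sets \<mu> = sets borel" by (simp add: \<mu>_def)
  fix f :: "complex \<Rightarrow> ennreal" assume [measurable]: "f \<in> borel_measurable borel"
  have "(\<integral>\<^sup>+z. f z \<partial>\<mu>) = (\<integral>\<^sup>+x. f (T x) \<partial>(?U \<Otimes>\<^sub>M \<nu>))"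
    unfolding \<mu>_def by (rule nn_integral_distr) simp_all
  also have "\<dots> = (\<integral>\<^sup>+k. \<integral>\<^sup>+z. f (z + j k) \<partial>\<nu> \<partial>?U)"
  proof -
    have "(\<lambda>x. f (T x)) \<in> borel_measurable (?U \<Otimes>\<^sub>M \<nu>)" by measurable
    from nn_integral_fst[OF this] show ?thesis by (simp add: T_def)
  qed
  also have "\<dots> = (\<Sum>k<n. \<integral>\<^sup>+z. f (z + j k) \<partial>\<nu>) / of_nat n"
    using n by (subst nn_integral_pmf_of_set) auto
  finally show "(\<integral>\<^sup>+z. f z \<partial>\<mu>) = (\<Sum>k<n. \<integral>\<^sup>+z. f (z + j k) \<partial>\<nu>) / of_nat n" .
qed

lemma double_nn_integral_average_of_translates:
  fixes \<mu> \<nu> :: "complex measure"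
  assumes nu: "prob_space \<nu>" "sets \<nu> = sets borel" and mu: "prob_space \<mu>" "sets \<mu> = sets borel"
    and avg: "\<And>f. f \<in> borel_measurable borel \<Longrightarrow>
      (\<integral>\<^sup>+z. f z \<partial>\<mu>) = (\<Sum>k<n. \<integral>\<^sup>+z. f (z + j k) \<partial>\<nu>) / of_nat n"
    and g: "case_prod g \<in> borel_measurable (borel \<Otimes>\<^sub>M borel)"
  shows "(\<integral>\<^sup>+z. \<integral>\<^sup>+w. g z w \<partial>\<mu> \<partial>\<mu>)
    = (\<Sum>k<n. (\<Sum>l<n. \<integral>\<^sup>+z. \<integral>\<^sup>+w. g (z + j k) (w + j l) \<partial>\<nu> \<partial>\<nu>) / of_nat n) / of_nat n"
proof -
  interpret nu: prob_space \<nu> by fact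
  interpret mu: prob_space \<mu> by fact
  note [measurable] = g
  have m1: "(\<lambda>w. g z w) \<in> borel_measurable borel" for z
    using measurable_Pair2[OF g, of z] by simp
  have "case_prod g \<in> borel_measurable (borel \<Otimes>\<^sub>M \<mu>)"
    using g mu(2) by (simp cong: measurable_cong_sets sets_pair_measure_cong)
  then have m2: "(\<lambda>z. \<integral>\<^sup>+w. g z w \<partial>\<mu>) \<in> borel_measurable borel"
    by (rule mu.borel_measurable_nn_integral)
  have m3: "(\<lambda>z. \<integral>\<^sup>+w. g (z + a) (w + b) \<partial>\<nu>) \<in> borel_measurable \<nu>" for a b
  proof -
    have "(\<lambda>(z, w). g (z + a) (w + b)) \<in> borel_measurable (borel \<Otimes>\<^sub>M borel)"
      by measurable
    then have "(\<lambda>(z, w). g (z + a) (w + b)) \<in> borel_measurable (\<nu> \<Otimes>\<^sub>M \<nu>)"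
      using nu(2) by (simp cong: measurable_cong_sets sets_pair_measure_cong)
    then show ?thesis by (rule nu.borel_measurable_nn_integral)
  qed
  have "(\<integral>\<^sup>+z. \<integral>\<^sup>+w. g z w \<partial>\<mu> \<partial>\<mu>)
      = (\<Sum>k<n. \<integral>\<^sup>+z. (\<Sum>l<n. \<integral>\<^sup>+w. g (z + j k) (w + j l) \<partial>\<nu>) / of_nat n \<partial>\<nu>) / of_nat n"
    by (subst avg[OF m2]) (simp only: avg[OF m1])
  then show ?thesis
    using m3 by (simp add: nn_integral_divide nn_integral_sum)
qed

lemma AE_average_of_translates:
  assumes nu: "AE z in \<nu>. z \<in> E" and mu: "sets \<mu> = sets borel"
    and avg: "\<And>f. f \<in> borel_measurable borel \<Longrightarrow>
      (\<integral>\<^sup>+z. f z \<partial>\<mu>) = (\<Sum>k<n. \<integral>\<^sup>+z. f (z + j k) \<partial>\<nu>) / of_nat n"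
    and K: "closed K" "\<And>k z. k < n \<Longrightarrow> z \<in> E \<Longrightarrow> z + j k \<in> K" and n: "n > 0"
  shows "AE z in \<mu>. z \<in> K"
proof -
  have K'[measurable]: "- K \<in> sets borel" using K(1) by auto
  have "(\<integral>\<^sup>+z. indicator (- K) (z + j k) \<partial>\<nu>) = 0" if "k < n" for k
  proof -
    have "AE z in \<nu>. indicator (- K) (z + j k) = (0 :: ennreal)"
      using nu by eventually_elim (use K(2)[OF that] in auto)
    then have "(\<integral>\<^sup>+z. indicator (- K) (z + j k) \<partial>\<nu>) = (\<integral>\<^sup>+z. 0 \<partial>\<nu>)"
      by (rule nn_integral_cong_AE)
    then show ?thesis by simp
  qed
  then have "(\<integral>\<^sup>+z. indicator (- K) z \<partial>\<mu>) = 0"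
    using n by (subst avg) auto
  then have "emeasure \<mu> (- K) = 0"
    using mu K' by (subst (asm) nn_integral_indicator) auto
  then show ?thesis
    using mu K' by (intro AE_I[where N = "- K"]) auto
qed

lemma average_sum_ennreal:
  assumes "\<And>k l. k < n \<Longrightarrow> l < n \<Longrightarrow> 0 \<le> t k l" and n: "n > 0"
  shows "(\<Sum>k<n. (\<Sum>l<n. ennreal (t k l)) / of_nat n) / of_nat n
    = ennreal ((\<Sum>k<n. \<Sum>l<n. t k l) / (real n * real n))"
proof -
  have "(\<Sum>k<n. (\<Sum>l<n. ennreal (t k l)) / of_nat n) = (\<Sum>k<n. ennreal ((\<Sum>l<n. t k l) / real n))"
  proof (rule sum.cong[OF refl])
    fix k assume "k \<in> {..<n}"
    then have "(\<Sum>l<n. ennreal (t k l)) = ennreal (\<Sum>l<n. t k l)" "0 \<le> (\<Sum>l<n. t k l)"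
      using assms(1) by (auto intro!: sum_ennreal sum_nonneg)
    then show "(\<Sum>l<n. ennreal (t k l)) / of_nat n = ennreal ((\<Sum>l<n. t k l) / real n)"
      using n by (simp add: ennreal_of_nat_eq_real_of_nat divide_ennreal)
  qed
  also have "\<dots> = ennreal (\<Sum>k<n. (\<Sum>l<n. t k l) / real n)"
    using assms(1) by (intro sum_ennreal divide_nonneg_nonneg sum_nonneg) auto
  also have "(\<Sum>k<n. (\<Sum>l<n. t k l) / real n) = (\<Sum>k<n. \<Sum>l<n. t k l) / real n"
    by (simp add: sum_divide_distrib)
  also have "ennreal \<dots> / of_nat n = ennreal ((\<Sum>k<n. \<Sum>l<n. t k l) / (real n * real n))"
  proof -
    have "0 \<le> (\<Sum>k<n. \<Sum>l<n. t k l) / real n"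
      using assms(1) by (intro divide_nonneg_nonneg sum_nonneg) auto
    then show ?thesis using n by (simp add: ennreal_of_nat_eq_real_of_nat divide_ennreal)
  qed
  finally show ?thesis .
qed

section \<open>Energy of the test measure\<close>

lemma log_gap_rescale:
  assumes "1 \<le> R" "cmod (z - w) \<le> 1"
  shows "log_gap R (z + c) (w + c) = ennreal (ln R) + log_gap 1 z w"
proof (cases "z = w")
  case False
  then have "0 < cmod (z - w)" by simp
  with assms False show ?thesis
    by (simp add: log_gap_def ln_div ennreal_plus[symmetric] ln_le_zero_iff del: ennreal_plus)
qed (simp add: log_gap_def)

text \<open>
  Rounding the two reals up changes their distance by less than 1, and moving the points by at
  most \<open>1/4\<close> changes it by at most \<open>1/2\<close> more. Since the rounded values differ by at least
  1, the logarithm decreases by at most a constant over 1 plus the distance.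
\<close>
lemma log_gap_translate_le:
  fixes p q :: real and i j :: nat
  assumes ij: "i \<noteq> j" and i: "i = nat \<lceil>p\<rceil>" and j: "j = nat \<lceil>q\<rceil>" and pq: "0 < p" "0 < q" "p \<noteq> q"
    and z: "cmod z \<le> 1 / 4" and w: "cmod w \<le> 1 / 4" and R: "1 \<le> R"
  shows "log_gap R (z + of_nat i) (w + of_nat j) \<le> ennreal (ln R - ln \<bar>p - q\<bar> + 9 / (1 + \<bar>p - q\<bar>))"
proof -
  define d where "d = \<bar>real i - real j\<bar>"
  have d: "1 \<le> d" using ij by (simp add: d_def)
  have "real i = of_int \<lceil>p\<rceil>" "real j = of_int \<lceil>q\<rceil>" using i j pq by auto
  then have "real i - 1 < p" "p \<le> real i" "real j - 1 < q" "q \<le> real j" by linarith+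
  then have upper: "\<bar>p - q\<bar> \<le> d + 1" unfolding d_def by linarith
  have "of_nat i - of_nat j = (complex_of_real (real i - real j))" by simp
  then have "cmod (of_nat i - of_nat j) = d" by (simp only: norm_of_real d_def real_norm_def)
  moreover have "cmod (of_nat i - of_nat j) \<le> cmod (z + of_nat i - (w + of_nat j)) + cmod (w - z)"
    using norm_triangle_ineq[of "z + of_nat i - (w + of_nat j)" "w - z"] by (simp add: algebra_simps)
  moreover have "cmod (w - z) \<le> 1 / 2" using norm_triangle_ineq4[of w z] z w by simp
  ultimately have lower: "d - 1 / 2 \<le> cmod (z + of_nat i - (w + of_nat j))" by simp
  then have pos: "0 < cmod (z + of_nat i - (w + of_nat j))" using d by linarith
  have "ln \<bar>p - q\<bar> \<le> ln (d + 1)" using upper pq by simp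
  also have "ln (d + 1) = ln (d - 1 / 2) + ln (1 + (3 / 2) / (d - 1 / 2))"
  proof -
    have "d + 1 = (d - 1 / 2) * (1 + (3 / 2) / (d - 1 / 2))" using d by (simp add: field_simps)
    then show ?thesis using d ln_mult_pos[of "d - 1 / 2" "1 + (3 / 2) / (d - 1 / 2)"]
      by (simp add: add_pos_nonneg)
  qed
  also have "ln (1 + (3 / 2) / (d - 1 / 2)) \<le> (3 / 2) / (d - 1 / 2)"
    using d by (intro ln_add_one_self_le_self) auto
  also have "(3 / 2) / (d - 1 / 2) \<le> 9 / (1 + \<bar>p - q\<bar>)"
  proof -
    have "(3 / 2) * (1 + \<bar>p - q\<bar>) \<le> (3 / 2) * (d + 2)"
      using upper by (intro mult_left_mono) auto
    also have "\<dots> \<le> 9 * (d - 1 / 2)" using d by simp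
    finally have "(3 / 2) * (1 + \<bar>p - q\<bar>) \<le> 9 * (d - 1 / 2)" .
    moreover have pos: "0 < d - 1 / 2" "0 < 1 + \<bar>p - q\<bar>" using d by linarith+
    ultimately show ?thesis
      using pos_divide_le_eq[OF pos(1)] pos_le_divide_eq[OF pos(2)] times_divide_eq_left
      by (metis (no_types, lifting))
  qed
  finally have "ln \<bar>p - q\<bar> - ln (d - 1 / 2) \<le> 9 / (1 + \<bar>p - q\<bar>)" by simp
  moreover have "ln (d - 1 / 2) \<le> ln (cmod (z + of_nat i - (w + of_nat j)))"
    using lower d by (intro ln_mono) auto
  ultimately have "ln (R / cmod (z + of_nat i - (w + of_nat j))) \<le> ln R - ln \<bar>p - q\<bar> + 9 / (1 + \<bar>p - q\<bar>)"
    using pos R by (subst ln_div) simp_all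
  then have "ennreal (ln (R / cmod (z + of_nat i - (w + of_nat j)))) \<le> ennreal (ln R - ln \<bar>p - q\<bar> + 9 / (1 + \<bar>p - q\<bar>))"
    by (rule ennreal_leI)
  moreover have "z + of_nat i \<noteq> w + of_nat j" using pos by auto
  ultimately show ?thesis by (simp only: log_gap_def if_False)
qed

text \<open>
  The translate assigned to a node; several nodes near the ends of the segment share one.
\<close>
definition cell :: "nat \<Rightarrow> nat \<Rightarrow> nat" where
  "cell n k = nat \<lceil>cheb_node n k\<rceil>"

lemma cell_bounds: "k < n \<Longrightarrow> cell n k \<in> {1..n}"
proof -
  assume k: "k < n"
  have "0 < \<lceil>cheb_node n k\<rceil>" using cheb_node_bounds(1)[OF k] by simp
  moreover have "\<lceil>cheb_node n k\<rceil> \<le> int n"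
    using cheb_node_bounds(2)[OF k] by (simp add: ceiling_le_iff)
  ultimately show ?thesis by (simp add: cell_def nat_le_iff Suc_le_eq)
qed

lemma cell_eqD: 
  assumes "k < n" "l < n" "cell n k = cell n l"
  shows "\<bar>cheb_node n k - cheb_node n l\<bar> \<le> 1"
proof -
  have "0 < \<lceil>cheb_node n k\<rceil>" "0 < \<lceil>cheb_node n l\<rceil>" 
    using cheb_node_bounds(1)[OF assms(1)] cheb_node_bounds(1)[OF assms(2)] by simp_all
  then have "\<lceil>cheb_node n k\<rceil> = \<lceil>cheb_node n l\<rceil>"
    using assms(3) by (simp add: cell_def eq_nat_nat_iff)
  then show ?thesis by linarith
qed

text \<open>
  The bound for the mutual energy of the translates belonging to nodes \<open>k\<close> and \<open>l\<close>: the
  mutual energy of the nodes, which is left out for \<open>k = l\<close>, and an error term.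
\<close>
definition pair_bound :: "real \<Rightarrow> nat \<Rightarrow> nat \<Rightarrow> nat \<Rightarrow> real" where
  "pair_bound c n k l = ln (real n) - (if k = l then 0 else ln \<bar>cheb_node n k - cheb_node n l\<bar>)
     + c / (1 + \<bar>cheb_node n k - cheb_node n l\<bar>)"

lemma pair_bound_nonneg:
  assumes "k < n" "l < n" "0 \<le> c"
  shows "0 \<le> pair_bound c n k l"
proof -
  have "ln \<bar>cheb_node n k - cheb_node n l\<bar> \<le> ln (real n)" if "k \<noteq> l"
    using cheb_node_bounds[OF assms(1)] cheb_node_bounds[OF assms(2)] cheb_node_eq_iff[OF assms(1,2)] that
    by (intro ln_mono) auto
  moreover have "0 \<le> c / (1 + \<bar>cheb_node n k - cheb_node n l\<bar>)" using assms by simp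
  ultimately show ?thesis using assms by (auto simp: pair_bound_def)
qed

text \<open>
  The error is \<open>O (1 / sqrt n)\<close> because each of the \<open>n\<close> rows of reciprocals sums to
  \<open>O (sqrt n)\<close>.
\<close>
lemma sum_pair_bound_le:
  assumes n: "1 \<le> n" and c: "0 \<le> c"
  shows "(\<Sum>k<n. \<Sum>l<n. pair_bound c n k l) / (real n * real n)
    \<le> ln (real n) - ln (real n / 4) + c * (1 + pi) / sqrt (real n)"
proof -
  let ?B = "real n * ln (real n) - real n * ln (real n / 4) + c * (1 + pi * sqrt (real n))"
  have row: "(\<Sum>l<n. pair_bound c n k l) \<le> ?B" if k: "k < n" for k
  proof -
    have "(\<Sum>l<n. pair_bound c n k l) = real n * ln (real n)
        - (\<Sum>l<n. if k = l then 0 else ln \<bar>cheb_node n k - cheb_node n l\<bar>)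
        + c * (\<Sum>l<n. 1 / (1 + \<bar>cheb_node n k - cheb_node n l\<bar>))"
      by (simp add: pair_bound_def sum.distrib sum_subtractf sum_distrib_left)
    also have "(\<Sum>l<n. if k = l then 0 else ln \<bar>cheb_node n k - cheb_node n l\<bar>)
        = (\<Sum>l\<in>{..<n} - {k}. ln \<bar>cheb_node n k - cheb_node n l\<bar>)"
      using k by (subst sum.remove[of _ k]) (auto intro!: sum.cong)
    finally show ?thesis
      using sum_log_cheb_node_dist_ge[OF k] mult_left_mono[OF sum_recip_cheb_node_dist_le[OF k] c]
      by linarith
  qed
  have "(\<Sum>k<n. \<Sum>l<n. pair_bound c n k l) \<le> real n * ?B"
    using sum_bounded_above[of "{..<n}" "\<lambda>k. \<Sum>l<n. pair_bound c n k l" ?B] row by simp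
  then have "(\<Sum>k<n. \<Sum>l<n. pair_bound c n k l) / (real n * real n) \<le> (real n * ?B) / (real n * real n)"
    by (rule divide_right_mono) simp
  also have "\<dots> = ln (real n) - ln (real n / 4) + c * (1 + pi * sqrt (real n)) / real n"
    using n by (simp add: add_divide_distrib diff_divide_distrib)
  also have "c * (1 + pi * sqrt (real n)) / real n \<le> c * (1 + pi) / sqrt (real n)"
  proof -
    have "1 + pi * sqrt (real n) \<le> (1 + pi) * sqrt (real n)" using n by (simp add: distrib_right)
    then have "c * (1 + pi * sqrt (real n)) / real n \<le> c * ((1 + pi) * sqrt (real n)) / real n"
      using c by (intro divide_right_mono mult_left_mono) auto
    also have "\<dots> = c * (1 + pi) * (sqrt (real n) / real n)" by simp
    also have "sqrt (real n) / real n = 1 / sqrt (real n)"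
      using n by (simp add: real_div_sqrt nonzero_divide_eq_eq nonzero_eq_divide_eq)
    finally show ?thesis by simp
  qed
  finally show ?thesis by simp
qed

text \<open>
  Two nodes with the same translate are at distance at most 1. There the energy
  \<open>V\<close> of \<open>\<nu>\<close> takes the place of the logarithm, and the error term, whose denominator is at most 2,
  has to absorb \<open>V\<close>. For different translates the kernels are compared pointwise.
\<close>
lemma translated_pair_energy_le:
  assumes nu: "prob_space \<nu>" "sets \<nu> = sets borel" "AE z in \<nu>. z \<in> E"
    and E: "E \<subseteq> {z. cmod z \<le> 1 / 4}"
    and V: "0 \<le> V" "(\<integral>\<^sup>+z. \<integral>\<^sup>+w. log_gap 1 z w \<partial>\<nu> \<partial>\<nu>) = ennreal V"
    and kl: "k < n" "l < n"
  shows "(\<integral>\<^sup>+z. \<integral>\<^sup>+w. log_gap (real n) (z + of_nat (cell n k)) (w + of_nat (cell n l)) \<partial>\<nu> \<partial>\<nu>)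
    \<le> ennreal (pair_bound (9 + 2 * V) n k l)"
proof -
  interpret prob_space \<nu> by fact
  let ?c = "9 + 2 * V" and ?d = "\<bar>cheb_node n k - cheb_node n l\<bar>"
  have n: "1 \<le> real n" using kl by simp
  have meas: "case_prod (log_gap 1) \<in> borel_measurable (\<nu> \<Otimes>\<^sub>M \<nu>)"
    using measurable_log_gap[of 1] nu(2) by (simp cong: measurable_cong_sets sets_pair_measure_cong)
  have meas1: "log_gap 1 z \<in> borel_measurable \<nu>" for z
    using measurable_Pair2[OF meas, of z] sets_eq_imp_space_eq[OF nu(2)] by simp
  have meas2: "(\<lambda>z. \<integral>\<^sup>+w. log_gap 1 z w \<partial>\<nu>) \<in> borel_measurable \<nu>"
    by (rule borel_measurable_nn_integral[OF meas])
  show ?thesis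
  proof (cases "cell n k = cell n l")
    case True
    have eq: "log_gap (real n) (z + of_nat (cell n k)) (w + of_nat (cell n l)) = ennreal (ln (real n)) + log_gap 1 z w"
      if "z \<in> E" "w \<in> E" for z w
    proof -
      have "cmod z \<le> 1 / 4" "cmod w \<le> 1 / 4" using that E by auto
      then have "cmod (z - w) \<le> 1" using norm_triangle_ineq4[of z w] by linarith
      then show ?thesis unfolding True by (intro log_gap_rescale n)
    qed
    have "(\<integral>\<^sup>+z. \<integral>\<^sup>+w. log_gap (real n) (z + of_nat (cell n k)) (w + of_nat (cell n l)) \<partial>\<nu> \<partial>\<nu>)
        = (\<integral>\<^sup>+z. \<integral>\<^sup>+w. ennreal (ln (real n)) + log_gap 1 z w \<partial>\<nu> \<partial>\<nu>)"
      by (rule nn_integral_cong_AE, use nu(3) in eventually_elim,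
          rule nn_integral_cong_AE, use nu(3) in eventually_elim) (rule eq)
    also have "\<dots> = ennreal (ln (real n) + V)"
      using meas1 meas2 V n by (simp add: nn_integral_add emeasure_space_1)
    also have "\<dots> \<le> ennreal (pair_bound ?c n k l)"
    proof (rule ennreal_leI)
      have d: "?d \<le> 1" using cell_eqD[OF kl True] .
      have "V * (1 + ?d) \<le> V * 2" using d V by (intro mult_left_mono) auto
      then have "V \<le> ?c / (1 + ?d)" by (simp add: pos_le_divide_eq add_pos_nonneg)
      moreover have "ln ?d \<le> 0" if "k \<noteq> l" using d cheb_node_eq_iff[OF kl] that by simp
      ultimately show "ln (real n) + V \<le> pair_bound ?c n k l" by (auto simp: pair_bound_def)
    qed
    finally show ?thesis .
  next
    case False
    then have "k \<noteq> l" by auto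
    have le: "log_gap (real n) (z + of_nat (cell n k)) (w + of_nat (cell n l)) \<le> ennreal (pair_bound ?c n k l)"
      if "z \<in> E" "w \<in> E" for z w
    proof -
      have "log_gap (real n) (z + of_nat (cell n k)) (w + of_nat (cell n l))
          \<le> ennreal (ln (real n) - ln ?d + 9 / (1 + ?d))"
        using False cheb_node_bounds[of _ n] kl cheb_node_eq_iff[OF kl] \<open>k \<noteq> l\<close> that E n
        by (intro log_gap_translate_le) (auto simp: cell_def)
      also have "\<dots> \<le> ennreal (pair_bound ?c n k l)"
        using \<open>k \<noteq> l\<close> V by (auto simp: pair_bound_def intro!: ennreal_leI divide_right_mono)
      finally show ?thesis .
    qed
    have "(\<integral>\<^sup>+z. \<integral>\<^sup>+w. log_gap (real n) (z + of_nat (cell n k)) (w + of_nat (cell n l)) \<partial>\<nu> \<partial>\<nu>)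
        \<le> (\<integral>\<^sup>+z. \<integral>\<^sup>+w. ennreal (pair_bound ?c n k l) \<partial>\<nu> \<partial>\<nu>)"
      by (rule nn_integral_mono_AE, use nu(3) in eventually_elim,
          rule nn_integral_mono_AE, use nu(3) in eventually_elim) (rule le)
    then show ?thesis by (simp add: emeasure_space_1)
  qed
qed

lemma compact_union_translates: "compact E \<Longrightarrow> compact (union_translates E n)"
  unfolding union_translates_def
  by (intro compact_UN compact_continuous_image continuous_intros) auto

lemma union_translates_diameter:
  assumes E: "E \<subseteq> {z. cmod z \<le> 1 / 4}" and zw: "z \<in> union_translates E n" "w \<in> union_translates E n"
  shows "cmod (z - w) \<le> real n"
proof -
  obtain p q a b where *: "z = a + of_nat p" "w = b + of_nat q" "a \<in> E" "b \<in> E"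
    "p \<in> {1..n}" "q \<in> {1..n}"
    using zw unfolding union_translates_def by blast
  have "complex_of_nat p - of_nat q = complex_of_real (real p - real q)" by simp
  then have "cmod (of_nat p - of_nat q) = \<bar>real p - real q\<bar>" by (simp only: norm_of_real)
  moreover have "\<bar>real p - real q\<bar> \<le> real n - 1" using *(5,6) by auto
  moreover have "cmod (z - w) \<le> cmod (a - b) + cmod (of_nat p - of_nat q)"
    using norm_triangle_ineq[of "a - b" "of_nat p - of_nat q"] by (simp add: * algebra_simps)
  moreover have "cmod a \<le> 1 / 4" "cmod b \<le> 1 / 4" using *(3,4) E by auto
  ultimately show ?thesis using norm_triangle_ineq4[of a b] by linarith
qed

text \<open>
  The energy of the averaged translates of \<open>\<nu>\<close> is \<open>ln n\<close> minus an average of mutual energies, and the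
  constant depends on \<open>E\<close> only through the energy of \<open>\<nu>\<close>.
\<close>
lemma log_capacity_union_translates_ge:
  fixes E :: "complex set"
  assumes E: "compact E" "E \<subseteq> {z. cmod z \<le> 1 / 4}"
    and nu: "prob_space \<nu>" "sets \<nu> = sets borel" "AE z in \<nu>. z \<in> E"
    and fin: "(\<integral>\<^sup>+z. \<integral>\<^sup>+w. log_gap 1 z w \<partial>\<nu> \<partial>\<nu>) < \<infinity>"
  shows "\<exists>C. \<forall>n\<ge>1. ennreal (real n / 4 * exp (- (C / sqrt (real n)))) \<le> log_capacity (union_translates E n)"
proof -
  interpret prob_space \<nu> by fact
  obtain V where V: "0 \<le> V" "(\<integral>\<^sup>+z. \<integral>\<^sup>+w. log_gap 1 z w \<partial>\<nu> \<partial>\<nu>) = ennreal V"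
    using fin by (cases "\<integral>\<^sup>+z. \<integral>\<^sup>+w. log_gap 1 z w \<partial>\<nu> \<partial>\<nu>") auto
  \<comment> \<open>9 comes from pairs with different translates, \<open>2 * V\<close> from pairs with the same translate.\<close>
  define c where "c = 9 + 2 * V"
  have c: "0 \<le> c" using V by (simp add: c_def)
  have "ennreal (real n / 4 * exp (- (c * (1 + pi) / sqrt (real n)))) \<le> log_capacity (union_translates E n)"
    if n: "n \<ge> 1" for n
  proof -
    let ?K = "union_translates E n"
    obtain \<mu> where mu: "prob_space \<mu>" "sets \<mu> = sets borel"
      and avg: "\<And>f. f \<in> borel_measurable borel \<Longrightarrow>
        (\<integral>\<^sup>+z. f z \<partial>\<mu>) = (\<Sum>k<n. \<integral>\<^sup>+z. f (z + of_nat (cell n k)) \<partial>\<nu>) / of_nat n"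
      using exists_average_of_translates[OF nu(1,2), of n "\<lambda>k. of_nat (cell n k)"] n by auto
    have K: "compact ?K" using E(1) by (rule compact_union_translates)
    have AE: "AE z in \<mu>. z \<in> ?K"
    proof (rule AE_average_of_translates[OF nu(3) mu(2) avg])
      show "z + of_nat (cell n k) \<in> ?K" if "k < n" "z \<in> E" for k z
        using that cell_bounds[of k n] by (auto simp: union_translates_def)
    qed (use K n in \<open>auto intro: compact_imp_closed\<close>)
    define D where "D = (\<integral>\<^sup>+z. \<integral>\<^sup>+w. log_gap (real n) z w \<partial>\<mu> \<partial>\<mu>)"
    have energy: "log_energy \<mu> = ereal (ln (real n)) - enn2ereal D"
      unfolding D_def using n union_translates_diameter[OF E(2)]
      by (intro log_energy_eq[OF mu AE]) auto
    define s where "s = (\<Sum>k<n. \<Sum>l<n. pair_bound c n k l) / (real n * real n)"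
    have "0 \<le> s"
      unfolding s_def using pair_bound_nonneg c by (intro divide_nonneg_nonneg sum_nonneg) auto
    have "D = (\<Sum>k<n. (\<Sum>l<n. \<integral>\<^sup>+z. \<integral>\<^sup>+w.
        log_gap (real n) (z + of_nat (cell n k)) (w + of_nat (cell n l)) \<partial>\<nu> \<partial>\<nu>) / of_nat n) / of_nat n"
      unfolding D_def
      by (rule double_nn_integral_average_of_translates[OF nu(1,2) mu avg]) (use measurable_log_gap in auto)
    also have "\<dots> \<le> (\<Sum>k<n. (\<Sum>l<n. ennreal (pair_bound c n k l)) / of_nat n) / of_nat n"
      unfolding c_def
      by (intro divide_right_mono_ennreal sum_mono translated_pair_energy_le[OF nu E(2) V]) auto
    also have "\<dots> = ennreal s"
      unfolding s_def using pair_bound_nonneg c n by (intro average_sum_ennreal) auto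
    finally have "enn2ereal D \<le> ereal s"
      using \<open>0 \<le> s\<close> by (simp add: less_eq_ennreal.rep_eq enn2ereal_ennreal)
    moreover have "ln (real n / 4) - c * (1 + pi) / sqrt (real n) \<le> ln (real n) - s"
      using sum_pair_bound_le[OF n c] by (simp add: s_def)
    ultimately have "ereal (ln (real n / 4) - c * (1 + pi) / sqrt (real n)) \<le> log_energy \<mu>"
      unfolding energy by (cases "enn2ereal D") auto
    then have "ennreal (exp (ln (real n / 4) - c * (1 + pi) / sqrt (real n))) \<le> log_capacity ?K"
      by (rule log_capacity_ge[OF K mu AE])
    moreover have "exp (ln (real n / 4) - c * (1 + pi) / sqrt (real n))
        = real n / 4 * exp (- (c * (1 + pi) / sqrt (real n)))"
      using n exp_add[of "ln (real n / 4)" "- (c * (1 + pi) / sqrt (real n))"] by simp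
    ultimately show ?thesis by simp
  qed
  then show ?thesis by blast
qed

section \<open>Finite energy on a segment and on non-polar sets\<close>

text \<open>
  For distinct points, the sum on the right counts the \<open>i\<close> with \<open>|x - y| \<le> 2\<^sup>-\<^sup>i\<close>, and there are at
  least \<open>log\<^sub>2 (1 / |x - y|)\<close> of them. Integrating termwise then replaces the
  integration of a logarithm by a geometric series.
\<close>
lemma log_gap_of_real_le:
  "log_gap 1 (of_real x) (of_real y) \<le> (\<Sum>i. indicator {x - (1 / 2) ^ i .. x + (1 / 2) ^ i} y)"
proof (cases "x = y")
  case True
  have "ennreal r < (\<Sum>i. 1)" for r
  proof -
    obtain m where m: "max r 0 < real m" using reals_Archimedean2 by blast
    then have "ennreal r < of_nat m"
      by (simp add: ennreal_of_nat_eq_real_of_nat ennreal_less_iff ennreal_lessI)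
    also have "of_nat m = (\<Sum>i<m. 1 :: ennreal)" by simp
    also have "\<dots> \<le> (\<Sum>i. 1)" by (intro sum_le_suminf) auto
    finally show ?thesis .
  qed
  then have "(\<Sum>i. 1 :: ennreal) = \<infinity>"
    by (cases "\<Sum>i. 1 :: ennreal") (auto simp: less_le)
  then show ?thesis using True by simp
next
  case False
  define m where "m = nat \<lceil>log 2 (1 / \<bar>x - y\<bar>)\<rceil>"
  have t: "0 < \<bar>x - y\<bar>" using False by simp
  have "log_gap 1 (of_real x) (of_real y) = ennreal (ln (1 / \<bar>x - y\<bar>))"
    using False by (simp add: log_gap_def norm_of_real flip: of_real_diff)
  also have "\<dots> \<le> ennreal (real m)"
  proof (rule ennreal_leI)
    show "ln (1 / \<bar>x - y\<bar>) \<le> real m"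
    proof (cases "1 \<le> 1 / \<bar>x - y\<bar>")
      case True
      then have "0 \<le> ln (1 / \<bar>x - y\<bar>)" by simp
      then have "ln (1 / \<bar>x - y\<bar>) * ln 2 \<le> ln (1 / \<bar>x - y\<bar>) * 1"
        using ln_2_less_1 by (intro mult_left_mono) auto
      then have "ln (1 / \<bar>x - y\<bar>) \<le> log 2 (1 / \<bar>x - y\<bar>)"
        by (simp add: log_def pos_le_divide_eq)
      also have "\<dots> \<le> real m" by (simp add: m_def real_nat_ceiling_ge)
      finally show ?thesis .
    next
      case False
      then have "ln (1 / \<bar>x - y\<bar>) \<le> 0" using t by (subst ln_le_zero_iff) auto
      then show ?thesis by simp
    qed
  qed
  also have "\<dots> = (\<Sum>i<m. indicator {x - (1 / 2) ^ i .. x + (1 / 2) ^ i} y)"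
  proof -
    have "y \<in> {x - (1 / 2) ^ i .. x + (1 / 2) ^ i}" if "i < m" for i
    proof -
      have "real i < log 2 (1 / \<bar>x - y\<bar>)" using that by (simp add: m_def zless_nat_eq_int_zless less_ceiling_iff)
      then have "2 ^ i < 1 / \<bar>x - y\<bar>" using t by (simp add: less_log_iff powr_realpow)
      then have "\<bar>x - y\<bar> < (1 / 2) ^ i" using t by (simp add: power_one_over field_simps)
      then show ?thesis by auto
    qed
    then have "(\<Sum>i<m. indicator {x - (1 / 2) ^ i .. x + (1 / 2) ^ i} y) = (\<Sum>i<m. 1 :: ennreal)"
      by (intro sum.cong) auto
    then show ?thesis by (simp add: ennreal_of_nat_eq_real_of_nat)
  qed
  also have "\<dots> \<le> (\<Sum>i. indicator {x - (1 / 2) ^ i .. x + (1 / 2) ^ i} y)"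
    by (intro sum_le_suminf) auto
  finally show ?thesis .
qed

lemma exists_finite_energy_on_segment:
  obtains \<nu> where "prob_space \<nu>" "sets \<nu> = sets borel"
    "AE z in \<nu>. z \<in> complex_of_real ` {- 1 / 4 .. 1 / 4}"
    "(\<integral>\<^sup>+z. \<integral>\<^sup>+w. log_gap 1 z w \<partial>\<nu> \<partial>\<nu>) < \<infinity>"
proof
  define I where "I = {- 1 / 4 .. 1 / 4 :: real}"
  define U where "U = uniform_measure lborel I"
  define \<nu> where "\<nu> = distr U borel complex_of_real"
  have [measurable]: "I \<in> sets borel" by (simp add: I_def)
  have I: "emeasure lborel I = ennreal (1 / 2)" by (simp add: I_def)
  interpret U: prob_space U
    unfolding U_def by (rule prob_space_uniform_measure) (simp_all add: I)
  have setsU[measurable_cong]: "sets U = sets borel" by (simp add: U_def)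
  have T[measurable]: "complex_of_real \<in> borel_measurable U" by measurable
  show prob: "prob_space \<nu>" unfolding \<nu>_def by (rule U.prob_space_distr) measurable
  show sets: "sets \<nu> = sets borel" by (simp add: \<nu>_def)
  interpret nu: prob_space \<nu> by fact
  have "AE x in U. x \<in> I" unfolding U_def by (rule AE_uniform_measureI) auto
  then show "AE z in \<nu>. z \<in> complex_of_real ` {- 1 / 4 .. 1 / 4}"
  proof -
    have "closed (complex_of_real ` I)"
      unfolding I_def by (intro compact_imp_closed compact_continuous_image continuous_intros) auto
    then have [measurable]: "complex_of_real ` I \<in> sets borel" by simp
    show ?thesis
      unfolding \<nu>_def I_def[symmetric] using \<open>AE x in U. x \<in> I\<close>
      by (subst AE_distr_iff) (auto elim!: AE_mp)
  qed
  have g: "case_prod (log_gap 1) \<in> borel_measurable (borel \<Otimes>\<^sub>M borel)" using measurable_log_gap by simp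
  have g1: "log_gap 1 z \<in> borel_measurable borel" for z using measurable_Pair2[OF g, of z] by simp
  have g2: "(\<lambda>z. \<integral>\<^sup>+w. log_gap 1 z w \<partial>\<nu>) \<in> borel_measurable borel"
  proof -
    have "case_prod (log_gap 1) \<in> borel_measurable (borel \<Otimes>\<^sub>M \<nu>)"
      using g sets by (simp cong: measurable_cong_sets sets_pair_measure_cong)
    then show ?thesis by (rule nu.borel_measurable_nn_integral)
  qed
  have inner: "(\<integral>\<^sup>+y. log_gap 1 (of_real x) (of_real y) \<partial>U) \<le> 8" for x
  proof -
    have "(\<integral>\<^sup>+y. log_gap 1 (of_real x) (of_real y) \<partial>U)
        \<le> (\<integral>\<^sup>+y. (\<Sum>i. indicator {x - (1 / 2) ^ i .. x + (1 / 2) ^ i} y) \<partial>U)"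
      by (intro nn_integral_mono log_gap_of_real_le)
    also have "\<dots> = (\<Sum>i. emeasure U {x - (1 / 2) ^ i .. x + (1 / 2) ^ i})"
      by (subst nn_integral_suminf) (auto simp: setsU)
    also have "\<dots> \<le> (\<Sum>i. ennreal (4 * (1 / 2) ^ i))"
    proof (intro suminf_le)
      fix i :: nat
      have "emeasure U {x - (1 / 2) ^ i .. x + (1 / 2) ^ i}
          = emeasure lborel (I \<inter> {x - (1 / 2) ^ i .. x + (1 / 2) ^ i}) / ennreal (1 / 2)"
        unfolding U_def by (subst emeasure_uniform_measure) (auto simp: I)
      also have "\<dots> \<le> emeasure lborel {x - (1 / 2) ^ i .. x + (1 / 2) ^ i} / ennreal (1 / 2)"
        by (intro divide_right_mono_ennreal emeasure_mono) auto
      also have "\<dots> = ennreal (4 * (1 / 2) ^ i)"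
      proof -
        have "emeasure lborel {x - (1 / 2) ^ i .. x + (1 / 2) ^ i} = ennreal (2 * (1 / 2) ^ i)" by simp
        moreover have "ennreal (2 * (1 / 2) ^ i) / ennreal (1 / 2) = ennreal (4 * (1 / 2) ^ i)"
          by (subst divide_ennreal) auto
        ultimately show ?thesis by (simp only:)
      qed
      finally show "emeasure U {x - (1 / 2) ^ i .. x + (1 / 2) ^ i} \<le> ennreal (4 * (1 / 2) ^ i)" .
    qed auto
    also have "\<dots> = ennreal 8"
    proof (rule suminf_ennreal_eq)
      show "(\<lambda>i. 4 * (1 / 2) ^ i) sums (8 :: real)"
        using sums_mult[OF geometric_sums[of "1 / 2 :: real"], of 4] by simp
    qed auto
    finally show ?thesis by simp
  qed
  have "(\<integral>\<^sup>+z. \<integral>\<^sup>+w. log_gap 1 z w \<partial>\<nu> \<partial>\<nu>) = (\<integral>\<^sup>+x. \<integral>\<^sup>+w. log_gap 1 (of_real x) w \<partial>\<nu> \<partial>U)"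
    using g2 by (subst (1) \<nu>_def) (simp add: nn_integral_distr)
  also have "\<dots> = (\<integral>\<^sup>+x. \<integral>\<^sup>+y. log_gap 1 (of_real x) (of_real y) \<partial>U \<partial>U)"
    using g1 by (simp add: \<nu>_def nn_integral_distr)
  also have "\<dots> \<le> (\<integral>\<^sup>+x. 8 \<partial>U)" by (intro nn_integral_mono inner)
  also have "\<dots> < \<infinity>" by (simp add: U.emeasure_space_1)
  finally show "(\<integral>\<^sup>+z. \<integral>\<^sup>+w. log_gap 1 z w \<partial>\<nu> \<partial>\<nu>) < \<infinity>" .
qed

lemma log_capacity_segment_ge:
  "\<exists>C. \<forall>n\<ge>2. ennreal ((real n - 1) / 4 * exp (- (C / sqrt (real n - 1))))
    \<le> log_capacity (complex_of_real ` {0..real n})"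
proof -
  let ?I = "complex_of_real ` {- 1 / 4 .. 1 / 4}"
  obtain \<nu> where nu: "prob_space \<nu>" "sets \<nu> = sets borel" "AE z in \<nu>. z \<in> ?I"
    "(\<integral>\<^sup>+z. \<integral>\<^sup>+w. log_gap 1 z w \<partial>\<nu> \<partial>\<nu>) < \<infinity>"
    by (rule exists_finite_energy_on_segment)
  have "compact ?I" by (intro compact_continuous_image continuous_intros) auto
  moreover have "?I \<subseteq> {z. cmod z \<le> 1 / 4}" by auto
  ultimately obtain C where C: "\<And>n. n \<ge> 1 \<Longrightarrow>
      ennreal (real n / 4 * exp (- (C / sqrt (real n)))) \<le> log_capacity (union_translates ?I n)"
    using log_capacity_union_translates_ge[OF _ _ nu] by blast
  have "ennreal ((real n - 1) / 4 * exp (- (C / sqrt (real n - 1)))) \<le> log_capacity (complex_of_real ` {0..real n})"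
    if n: "n \<ge> 2" for n
  proof -
    have "union_translates ?I (n - 1) \<subseteq> complex_of_real ` {0..real n}"
    proof
      fix z assume "z \<in> union_translates ?I (n - 1)"
      then obtain j x where j: "j \<in> {1..n - 1}" "x \<in> {- 1 / 4 .. 1 / 4}" "z = of_real x + of_nat j"
        unfolding union_translates_def by blast
      have "real j + 1 \<le> real n" using j(1) n by auto
      then have "x + real j \<in> {0..real n}" using j(1,2) by auto
      moreover have "z = of_real (x + real j)" using j(3) by simp
      ultimately show "z \<in> complex_of_real ` {0..real n}" by blast
    qed
    then have "log_capacity (union_translates ?I (n - 1)) \<le> log_capacity (complex_of_real ` {0..real n})"
      by (rule log_capacity_mono)
    moreover have "ennreal ((real n - 1) / 4 * exp (- (C / sqrt (real n - 1)))) \<le> log_capacity (union_translates ?I (n - 1))"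
      using C[of "n - 1"] n by (simp add: of_nat_diff)
    ultimately show ?thesis by (rule order.trans[rotated])
  qed
  then show ?thesis by blast
qed

lemma not_polar_imp_finite_energy:
  assumes "\<not> polar_set E" and E: "E \<subseteq> {z. cmod z \<le> 1 / 4}"
  obtains \<nu> where "prob_space \<nu>" "sets \<nu> = sets borel" "AE z in \<nu>. z \<in> E"
    "(\<integral>\<^sup>+z. \<integral>\<^sup>+w. log_gap 1 z w \<partial>\<nu> \<partial>\<nu>) < \<infinity>"
proof -
  have "log_capacity E \<noteq> 0" using assms(1) by (simp add: polar_set_def)
  then obtain M where M: "sets M = sets borel" "prob_space M" "measure_support M \<subseteq> E"
    and energy: "exp_ereal (log_energy M) \<noteq> 0"
    unfolding log_capacity_def by (force simp: SUP_eq_iff bot_ennreal[symmetric] SUP_bot_conv)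
  have AE: "AE z in M. z \<in> E" using AE_measure_support[OF M(1)] M(3) by (auto elim!: AE_mp)
  have "cmod (z - w) \<le> 1" if "z \<in> E" "w \<in> E" for z w
  proof -
    have "cmod z \<le> 1 / 4" "cmod w \<le> 1 / 4" using that E by auto
    then show ?thesis using norm_triangle_ineq4[of z w] by linarith
  qed
  then have eq: "log_energy M = ereal (ln 1) - enn2ereal (\<integral>\<^sup>+z. \<integral>\<^sup>+w. log_gap 1 z w \<partial>M \<partial>M)"
    by (intro log_energy_eq[OF M(2,1) AE]) auto
  have "(\<integral>\<^sup>+z. \<integral>\<^sup>+w. log_gap 1 z w \<partial>M \<partial>M) \<noteq> \<infinity>"
  proof
    assume "(\<integral>\<^sup>+z. \<integral>\<^sup>+w. log_gap 1 z w \<partial>M \<partial>M) = \<infinity>"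
    then show False using energy by (simp add: eq exp_ereal_def)
  qed
  then show ?thesis using that[OF M(2,1) AE] by (simp add: less_top)
qed

section \<open>Asymptotics of the capacity\<close>

theorem theorem1p2:
  fixes E :: "complex set"
  assumes "compact E" and "\<not> polar_set E" and "E \<subseteq> {z. cmod z \<le> 1 / 4}"
  shows "((\<lambda>n. log_capacity (union_translates E n) / log_capacity (complex_of_real ` {0..real n}))
            \<longlonglongrightarrow> 1)
       \<and> (\<lambda>n. ln (enn2real (log_capacity (union_translates E n))) - ln (real n / 4))
            \<in> O(\<lambda>n. 1 / sqrt (real n))"
proof -
  define \<alpha> where "\<alpha> = (\<lambda>n. enn2real (log_capacity (union_translates E n)))"
  define \<beta> where "\<beta> = (\<lambda>n. enn2real (log_capacity (complex_of_real ` {0..real n})))"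
  obtain \<nu> where nu: "prob_space \<nu>" "sets \<nu> = sets borel" "AE z in \<nu>. z \<in> E"
    "(\<integral>\<^sup>+z. \<integral>\<^sup>+w. log_gap 1 z w \<partial>\<nu> \<partial>\<nu>) < \<infinity>"
    using not_polar_imp_finite_energy[OF assms(2,3)] by blast
  obtain C where C: "\<And>n. n \<ge> 1 \<Longrightarrow>
      ennreal (real n / 4 * exp (- (C / sqrt (real n)))) \<le> log_capacity (union_translates E n)"
    using log_capacity_union_translates_ge[OF assms(1,3) nu] by blast
  obtain C' where C': "\<And>n. n \<ge> 2 \<Longrightarrow>
      ennreal ((real n - 1) / 4 * exp (- (C' / sqrt (real n - 1)))) \<le> log_capacity (complex_of_real ` {0..real n})"
    using log_capacity_segment_ge by blast
  have between: "a \<le> enn2real X \<and> enn2real X \<le> b \<and> X = ennreal (enn2real X)"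
    if "ennreal a \<le> X" "X \<le> ennreal b" "0 \<le> b" for a b X
    using that by (cases X) (auto simp: top_unique ennreal_le_iff2 intro: order.trans)
  have \<alpha>: "real n / 4 * exp (- (C / sqrt (real n))) \<le> \<alpha> n" "\<alpha> n \<le> real n / 4 * exp (1 / sqrt (real n))"
    "log_capacity (union_translates E n) = ennreal (\<alpha> n)" if "n \<ge> 1" for n
    using between[OF C[OF that] log_capacity_union_translates_le[OF assms(3) that]]
    by (auto simp: \<alpha>_def)
  have \<beta>: "(real n - 1) / 4 * exp (- (C' / sqrt (real n - 1))) \<le> \<beta> n" "\<beta> n \<le> real n / 4"
    "log_capacity (complex_of_real ` {0..real n}) = ennreal (\<beta> n)" if "n \<ge> 2" for n
    using between[OF C'[OF that] log_capacity_segment_le[of n]] that by (auto simp: \<beta>_def)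
  have \<alpha>_pos: "0 < \<alpha> n" if "n \<ge> 1" for n
    using \<alpha>(1)[OF that] that by (intro less_le_trans[OF _ \<alpha>(1)]) auto
  have \<beta>_pos: "0 < \<beta> n" if "n \<ge> 2" for n
    using that by (intro less_le_trans[OF _ \<beta>(1)]) auto

  have "(\<lambda>n. \<alpha> n / \<beta> n) \<longlonglongrightarrow> 1"
  proof (rule tendsto_sandwich)
    show "\<forall>\<^sub>F n in sequentially. exp (- (C / sqrt (real n))) \<le> \<alpha> n / \<beta> n"
      using eventually_ge_at_top[of 2]
    proof eventually_elim
      case (elim n)
      have "exp (- (C / sqrt (real n))) * \<beta> n \<le> exp (- (C / sqrt (real n))) * (real n / 4)"
        using \<beta>(2)[OF elim] by (intro mult_left_mono) auto
      also have "\<dots> \<le> \<alpha> n" using \<alpha>(1)[of n] elim by (simp add: mult.commute)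
      finally show ?case using \<beta>_pos[OF elim] by (simp add: pos_le_divide_eq)
    qed
    show "\<forall>\<^sub>F n in sequentially. \<alpha> n / \<beta> n \<le>
        real n / (real n - 1) * exp (1 / sqrt (real n)) * exp (C' / sqrt (real n - 1))"
      using eventually_ge_at_top[of 2]
    proof eventually_elim
      case (elim n)
      let ?b = "(real n - 1) / 4 * exp (- (C' / sqrt (real n - 1)))"
      have "\<alpha> n / \<beta> n \<le> (real n / 4 * exp (1 / sqrt (real n))) / ?b"
        using \<alpha>(2)[of n] \<alpha>_pos[of n] \<beta>(1)[OF elim] elim by (intro frac_le) auto
      also have "\<dots> = real n / (real n - 1) * exp (1 / sqrt (real n)) * exp (C' / sqrt (real n - 1))"
        using elim by (simp add: exp_minus field_simps)
      finally show ?case .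
    qed
    have lim: "(\<lambda>n. a / sqrt (real n)) \<longlonglongrightarrow> 0" "(\<lambda>n. a / sqrt (real n - 1)) \<longlonglongrightarrow> 0" for a
      by real_asymp+
    have "(\<lambda>n. exp (- (C / sqrt (real n)))) \<longlonglongrightarrow> exp (- 0)"
      by (intro tendsto_intros lim)
    then show "(\<lambda>n. exp (- (C / sqrt (real n)))) \<longlonglongrightarrow> 1" by simp
    have "(\<lambda>n. real n / (real n - 1)) \<longlonglongrightarrow> 1" by real_asymp
    then have "(\<lambda>n. real n / (real n - 1) * exp (1 / sqrt (real n)) * exp (C' / sqrt (real n - 1)))
        \<longlonglongrightarrow> 1 * exp 0 * exp 0"
      by (intro tendsto_intros lim)
    then show "(\<lambda>n. real n / (real n - 1) * exp (1 / sqrt (real n)) * exp (C' / sqrt (real n - 1))) \<longlonglongrightarrow> 1"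
      by simp
  qed
  then have lim: "(\<lambda>n. ennreal (\<alpha> n / \<beta> n)) \<longlonglongrightarrow> ennreal 1"
    by (rule tendsto_ennrealI)
  have "\<forall>\<^sub>F n in sequentially. ennreal (\<alpha> n / \<beta> n) =
      log_capacity (union_translates E n) / log_capacity (complex_of_real ` {0..real n})"
    using eventually_ge_at_top[of 2]
  proof eventually_elim
    case (elim n)
    have "0 \<le> \<alpha> n" using \<alpha>_pos[of n] elim by simp
    then show ?case using \<alpha>(3)[of n] \<beta>(3)[OF elim] \<beta>_pos[OF elim] elim by (simp add: divide_ennreal)
  qed
  then have "(\<lambda>n. log_capacity (union_translates E n) / log_capacity (complex_of_real ` {0..real n}))
      \<longlonglongrightarrow> 1"
    using Lim_transform_eventually[OF lim] by simp

  moreover have "(\<lambda>n. ln (\<alpha> n) - ln (real n / 4)) \<in> O(\<lambda>n. 1 / sqrt (real n))"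
  proof (rule bigoI)
    show "\<forall>\<^sub>F n in sequentially. norm (ln (\<alpha> n) - ln (real n / 4)) \<le> max C 1 * norm (1 / sqrt (real n))"
      using eventually_ge_at_top[of 1]
    proof eventually_elim
      case (elim n)
      have n: "0 < real n / 4" using elim by simp
      have "ln (real n / 4 * exp (- (C / sqrt (real n)))) \<le> ln (\<alpha> n)"
        using \<alpha>(1)[OF elim] n by (intro ln_mono) auto
      then have lower: "ln (real n / 4) - C / sqrt (real n) \<le> ln (\<alpha> n)"
        using n by (subst (asm) ln_mult) auto
      have "ln (\<alpha> n) \<le> ln (real n / 4 * exp (1 / sqrt (real n)))"
        using \<alpha>(2)[OF elim] \<alpha>_pos[OF elim] by (intro ln_mono) auto
      then have upper: "ln (\<alpha> n) \<le> ln (real n / 4) + 1 / sqrt (real n)"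
        using n by (subst (asm) ln_mult) auto
      have "C / sqrt (real n) \<le> max C 1 / sqrt (real n)" "1 / sqrt (real n) \<le> max C 1 / sqrt (real n)"
        by (intro divide_right_mono; simp)+
      then have "\<bar>ln (\<alpha> n) - ln (real n / 4)\<bar> \<le> max C 1 / sqrt (real n)"
        using lower upper by linarith
      then show ?case by simp
    qed
  qed
  ultimately show ?thesis unfolding \<alpha>_def by blast
qed

end
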